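(* Let $V$ be a simple, strongly finitely generated vertex operator algebra. Then $V$ satisfies the ascending chain condition on its right ideals: for every ascending chain $I_1 \subset I_2 \subset \dots \subset I_n \subset I_{n+1} \subset \dots$ of right ideals of $V$ there exists $N$ such that $I_n = I_N$ for all $n \geq N$.
   Context: All vector spaces are over $\mathbb{C}$. A differential graded left-symmetric algebra (DGLsA) is a non-negatively graded vector space $A=\bigoplus_{n\ge 0}A^n$ with all $A^n$ finite-dimensional, endowed with a bilinear unital product (in general neither commutative nor associative) whose associator $(a,b,c)=(ab)c-a(bc)$ satisfies $(a,b,c)=(b,a,c)$, and a derivation $\partial$ of this product, such that the unit $\mathbf{1}$ lies in $A^0$, $A^m\cdot A^n\subset A^{m+n}$ and $\partial A^n\subset A^{n+1}$. Vertex algebras $(V,Y,\mathbf{1},\partial)$ are defined as usual (field axiom, locality, vacuum axiom, translation invariance), with $Y(a,z)=\sum_{j\in\mathbb{Z}}a_{(j)}z^{-j-1}$. The normally ordered product is $ab=a_{(-1)}b$ and the $\lambda$-bracket is $[a_\lambda b]=\sum_{n\ge 0}\frac{\lambda^n}{n!}a_{(n)}b$. A vertex operator algebra (VOA) is a non-negatively graded vector space $V=\bigoplus_{n\ge 0}V^n$ with a vertex algebra structure such that: (i) the normally ordered product and $\partial$ make $V$ a DGLsA with unit $\mathbf{1}$; (ii) the torsion of $V$ as a $\mathbb{C}[\partial]$-module equals $V^0=\mathbb{C}\mathbf{1}$; (iii) there is a Virasoro element $\omega\in V^2$ satisfying $[\omega_\lambda\omega]=(\partial+2\lambda)\omega+\frac{c}{12}\lambda^3\mathbf{1}$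 for some $c\in\mathbb{C}$, and $[\omega_\lambda a]=(\partial+n\lambda)a+O(\lambda^2)$ for all $a\in V^n$. $V$ is strongly finitely generated if there is a finite subset such that the normally ordered products (with any parenthesization, including the empty product $\mathbf{1}$) of elements $\partial^i x$, $i\ge 0$, $x$ in the subset, linearly span $V$. A vertex algebra ideal is a $\mathbb{C}[\partial]$-submodule $I$ with $a_{(n)}b\in I$ for all $a\in I$, $b\in V$, $n\in\mathbb{Z}$; $V$ is simple if its only vertex algebra ideals are $0$ and $V$. A right ideal of $V$ is a homogeneous (i.e. graded) subspace $I\subset V$ with $\partial I\subset I$ and $ab\in I$ for all $a\in I$, $b\in V$, where $ab$ is the normally ordered product. *)

theory Defs
  imports Complex_Main "HOL-Computational_Algebra.Polynomial"
begin

locale graded_vector_space = vector_space scale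
  for scale :: "complex \<Rightarrow> 'v::ab_group_add \<Rightarrow> 'v" +
  fixes gr :: "nat \<Rightarrow> 'v set"
  assumes subspace_gr: "subspace (gr n)"
    and direct_sum:
      "\<exists>!f. (\<forall>n. f n \<in> gr n) \<and> finite {n. f n \<noteq> 0} \<and> v = (\<Sum>n | f n \<noteq> 0. f n)"
begin

definition homogeneous_subspace :: "'v set \<Rightarrow> bool" where
  "homogeneous_subspace U \<longleftrightarrow> subspace U \<and> U = span (\<Union>n. U \<inter> gr n)"

end

locale dg_left_symmetric_algebra = graded_vector_space scale gr
  for scale :: "complex \<Rightarrow> 'v::ab_group_add \<Rightarrow> 'v"
    and gr :: "nat \<Rightarrow> 'v set" +
  fixes prd :: "'v \<Rightarrow> 'v \<Rightarrow> 'v"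
    and unit :: 'v
    and D :: "'v \<Rightarrow> 'v"
  assumes finite_dimensional_gr: "\<exists>B. finite B \<and> gr n = span B"
    and prd_linear_left: "Vector_Spaces.linear scale scale (\<lambda>a. prd a b)"
    and prd_linear_right: "Vector_Spaces.linear scale scale (\<lambda>b. prd a b)"
    and prd_unit_left: "prd unit a = a"
    and prd_unit_right: "prd a unit = a"
    and left_symmetric:
      "prd (prd a b) c - prd a (prd b c) = prd (prd b a) c - prd b (prd a c)"
    and D_linear: "Vector_Spaces.linear scale scale D"
    and D_derivation: "D (prd a b) = prd (D a) b + prd a (D b)"
    and unit_gr: "unit \<in> gr 0"
    and prd_gr: "\<lbrakk>a \<in> gr m; b \<in> gr n\<rbrakk> \<Longrightarrow> prd a b \<in> gr (m + n)"
    and D_gr: "a \<in> gr n \<Longrightarrow> D a \<in> gr (Suc n)"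

text \<open>
  A formal distribution \<open>F(z,w)\<close> with coefficients in the endomorphisms of \<open>V\<close> is represented
  by its modes: \<open>F m n\<close> is the coefficient of \<open>z\<close> to the \<open>-m-1\<close> times \<open>w\<close> to the \<open>-n-1\<close>.
  Multiplication by \<open>z\<close> therefore shifts the first index up by one.
\<close>

definition times_z_minus_w ::
    "(int \<Rightarrow> int \<Rightarrow> 'v \<Rightarrow> 'v::ab_group_add) \<Rightarrow> int \<Rightarrow> int \<Rightarrow> 'v \<Rightarrow> 'v" where
  "times_z_minus_w F = (\<lambda>m n v. F (m + 1) n v - F m (n + 1) v)"

text \<open>
  The state-field correspondence is given by its modes: \<open>Y a j b\<close> is \<open>a\<^bsub>(j)\<^esub>b\<close>, the coefficient
  of \<open>z\<close> to the \<open>-j-1\<close> in \<open>Y(a,z)b\<close>. The translation axioms are the coefficients of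
  \<open>[T, Y(a,z)] = Y(T a, z) = (d/dz) Y(a,z)\<close>, where \<open>T\<close> is the operator \<open>\<partial>\<close>.
\<close>

locale vertex_algebra = vector_space scale
  for scale :: "complex \<Rightarrow> 'v::ab_group_add \<Rightarrow> 'v" +
  fixes Y :: "'v \<Rightarrow> int \<Rightarrow> 'v \<Rightarrow> 'v"
    and vac :: 'v
    and T :: "'v \<Rightarrow> 'v"
  assumes Y_linear_left: "Vector_Spaces.linear scale scale (\<lambda>a. Y a j b)"
    and Y_linear_right: "Vector_Spaces.linear scale scale (\<lambda>b. Y a j b)"
    and T_linear: "Vector_Spaces.linear scale scale T"
    and field_axiom: "\<exists>N. \<forall>j\<ge>N. Y a j b = 0"
    and locality:
      "\<exists>N. (times_z_minus_w ^^ N) (\<lambda>m n v. Y a m (Y b n v) - Y b n (Y a m v)) = (\<lambda>m n v. 0)"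
    and vacuum_left: "Y vac j b = (if j = - 1 then b else 0)"
    and vacuum_creation: "Y a (- 1) vac = a"
    and vacuum_regular: "j \<ge> 0 \<Longrightarrow> Y a j vac = 0"
    and translation_commutator: "T (Y a j b) - Y a j (T b) = scale (of_int (- j)) (Y a (j - 1) b)"
    and translation_derivative: "Y (T a) j b = scale (of_int (- j)) (Y a (j - 1) b)"
begin

definition normally_ordered :: "'v \<Rightarrow> 'v \<Rightarrow> 'v"  (infixl \<open>\<bullet>\<close> 70) where
  "a \<bullet> b = Y a (- 1) b"

definition lambda_bracket :: "'v \<Rightarrow> 'v \<Rightarrow> 'v poly" where
  "lambda_bracket a b = Abs_poly (\<lambda>n. scale (1 / fact n) (Y a (int n) b))"

lemma coeff_lambda_bracket:
  "coeff (lambda_bracket a b) n = scale (1 / fact n) (Y a (int n) b)"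
proof -
  obtain N where N: "\<And>j. j \<ge> N \<Longrightarrow> Y a j b = 0"
    using field_axiom by blast
  have "\<forall>n>nat N. scale (1 / fact n) (Y a (int n) b) = 0"
    using N by simp
  then have "\<forall>\<^sub>\<infinity>n. scale (1 / fact n) (Y a (int n) b) = 0"
    using MOST_nat by blast
  then show ?thesis
    unfolding lambda_bracket_def by (subst Abs_poly_inverse) auto
qed

definition poly_T :: "complex poly \<Rightarrow> 'v \<Rightarrow> 'v" where
  "poly_T p v = (\<Sum>i\<le>degree p. scale (coeff p i) ((T ^^ i) v))"

definition torsion :: "'v set" where
  "torsion = {v. \<exists>p. p \<noteq> 0 \<and> poly_T p v = 0}"

inductive_set normally_ordered_products :: "'v set \<Rightarrow> 'v set" for S :: "'v set" where
  empty_product: "vac \<in> normally_ordered_products S"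
| derivative: "x \<in> S \<Longrightarrow> (T ^^ i) x \<in> normally_ordered_products S"
| product: "\<lbrakk>a \<in> normally_ordered_products S; b \<in> normally_ordered_products S\<rbrakk>
    \<Longrightarrow> a \<bullet> b \<in> normally_ordered_products S"

definition strongly_finitely_generated :: bool where
  "strongly_finitely_generated \<longleftrightarrow>
     (\<exists>S. finite S \<and> span (normally_ordered_products S) = UNIV)"

definition va_ideal :: "'v set \<Rightarrow> bool" where
  "va_ideal I \<longleftrightarrow> subspace I \<and> (\<forall>a\<in>I. T a \<in> I) \<and> (\<forall>a\<in>I. \<forall>b n. Y a n b \<in> I)"

definition simple :: bool where
  "simple \<longleftrightarrow> (\<forall>I. va_ideal I \<longrightarrow> I = {0} \<or> I = UNIV)"

end

text \<open>
  In the Virasoro condition, \<open>[:x, y:]\<close> is \<open>x + \<lambda>y\<close>, and \<open>pCons 0 (pCons 0 r)\<close> is \<open>r\<close>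
  multiplied by the square of \<open>\<lambda>\<close>.
\<close>

locale vertex_operator_algebra = vertex_algebra scale Y vac T
  for scale :: "complex \<Rightarrow> 'v::ab_group_add \<Rightarrow> 'v"
    and Y :: "'v \<Rightarrow> int \<Rightarrow> 'v \<Rightarrow> 'v"
    and vac :: 'v
    and T :: "'v \<Rightarrow> 'v" +
  fixes gr :: "nat \<Rightarrow> 'v set"
  assumes dg_structure: "dg_left_symmetric_algebra scale gr normally_ordered vac T"
    and torsion_eq: "torsion = gr 0"
    and gr_0: "gr 0 = range (\<lambda>c. scale c vac)"
    and virasoro_element:
      "\<exists>\<omega>\<in>gr 2.
         (\<exists>c. lambda_bracket \<omega> \<omega> = [:T \<omega>, scale 2 \<omega>:] + monom (scale (c / 12) vac) 3) \<and>
         (\<forall>n. \<forall>a\<in>gr n. \<exists>r. lambda_bracket \<omega> a =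
            [:T a, scale (of_nat n) a:] + pCons 0 (pCons 0 r))"

sublocale vertex_operator_algebra \<subseteq> dg_left_symmetric_algebra scale gr normally_ordered vac T
  by (rule dg_structure)

context vertex_operator_algebra
begin

definition right_ideal :: "'v set \<Rightarrow> bool" where
  "right_ideal I \<longleftrightarrow>
     homogeneous_subspace I \<and> (\<forall>a\<in>I. T a \<in> I) \<and> (\<forall>a\<in>I. \<forall>b. a \<bullet> b \<in> I)"

end

end

theory Submission
  imports Defs "HOL-Library.Function_Algebras" "HOL-Library.Multiset_Order"
begin

text \<open>
  Noetherianity comes from one consequence of noncommutativity: in a simple vertex operator
  algebra, a nonzero right ideal \<open>J\<close> contains \<open>\<partial>\<^sup>M b\<close> for all vectors \<open>b\<close> and all large \<open>M\<close>, with a bound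
  on \<open>M\<close> that does not depend on \<open>b\<close> (\<open>right_ideal_contains_high_derivatives\<close>). Commutative differential
  algebra has no such phenomenon: the differential ideal generated by \<open>x\<^sup>2\<close> in the differential
  polynomials in \<open>x\<close> contains no derivative of \<open>x\<close>.

  To see this, take \<open>a \<in> J\<close> and \<open>b\<close>, \<open>c\<close> arbitrary. The vectors \<open>((\<partial>\<^sup>n a) b)\<^bsub>(m)\<^esub> c\<close> with \<open>m < 0\<close> lie in \<open>J\<close>.
  Expanding them into modes of \<open>a\<close> and \<open>b\<close> gives terms that begin with a negative mode of a derivative
  of \<open>a\<close>, which lie in \<open>J\<close>, and a combination of the vectors \<open>b\<^bsub>(s-i)\<^esub> (a\<^bsub>(i)\<^esub> c)\<close> with \<open>i \<ge> 0\<close>, with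
  coefficients \<open>n + i\<close> choose \<open>i\<close> up to a common factor, where \<open>s = m - 1 - n\<close>. There are finitely many \<open>i\<close>
  and, for fixed very negative \<open>s\<close>, many choices of \<open>n\<close>, so every single \<open>b\<^bsub>(s-i)\<^esub> (a\<^bsub>(i)\<^esub> c)\<close> lies in \<open>J\<close> (\<open>deep_modes_mem\<close>). Now the vertex algebra ideal generated
  by \<open>J\<close> is spanned by the vectors \<open>a\<^bsub>(i)\<^esub> c\<close> with \<open>a \<in> J\<close> (\<open>products_span_ideal\<close>), so by simplicity the
  vacuum is a combination of them, and comparing weights only \<open>i \<ge> 0\<close> is needed unless \<open>J\<close> is
  everything. Replacing \<open>a\<^bsub>(i)\<^esub> c\<close> by the vacuum turns the conclusion into \<open>b\<^bsub>(-1-M)\<^esub> vac \<in> J\<close> for large \<open>M\<close>,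
  and this vector is \<open>\<partial>\<^sup>M b\<close> up to a factorial.

  The rest follows the proof of Hilbert's basis theorem. Let \<open>J\<close> be a nonzero member of the chain. Filter \<open>V\<close> by the total
  weight of the vectors in a product, not counting derivatives; then commutators and associators
  have lower weight, so that products are commutative and associative up to lower terms. Modulo \<open>J\<close>
  the space \<open>V\<close> is spanned by monomials in the finitely many derivatives \<open>\<partial>\<^sup>d s\<close> of strong generators \<open>s\<close>
  with small \<open>d\<close> (\<open>Fil_reduced\<close>). The leading monomials of a right ideal are closed under multiplication,
  so the sets of leading monomials stabilize along the chain by Dickson's lemma, and right ideals
  above \<open>J\<close> with the same leading monomials are equal (\<open>same_leading_monomials_eq\<close>).

  The calculus of modes that all this uses (the expansion of a normally ordered product, the
  commutator formula and skew-symmetry) is derived from locality, through Dong's lemma and the fact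
  that a local field is determined by its values on the vacuum.
\<close>

section \<open>Nilpotency of commuting additive operators\<close>

lemma funpow_commute:
  assumes "\<And>x. f (g x) = g (f x)"
  shows "(f ^^ i) ((g ^^ j) x) = (g ^^ j) ((f ^^ i) x)"
proof -
  have 1: "f ((g ^^ j) x) = (g ^^ j) (f x)" for x
    by (induction j) (simp_all add: assms)
  show ?thesis by (induction i arbitrary: x) (simp_all add: 1)
qed

lemma funpow_additive:
  fixes f :: "'a::ab_group_add \<Rightarrow> 'a"
  assumes "\<And>x y. f (x + y) = f x + f y"
  shows "(f ^^ i) (x + y) = (f ^^ i) x + (f ^^ i) y" "(f ^^ i) 0 = 0"
    "(f ^^ i) (x - y) = (f ^^ i) x - (f ^^ i) y"
proof -
  show add: "(f ^^ i) (x + y) = (f ^^ i) x + (f ^^ i) y" for x y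
    by (induction i) (simp_all add: assms)
  show "(f ^^ i) 0 = 0" using add[of 0 0] by simp
  show "(f ^^ i) (x - y) = (f ^^ i) x - (f ^^ i) y" using add[of "x - y" y] by simp
qed

lemma funpow_vanish_mono:
  fixes f :: "'a::ab_group_add \<Rightarrow> 'a"
  assumes "\<And>x y. f (x + y) = f x + f y" "(f ^^ i) x = 0" "i \<le> j"
  shows "(f ^^ j) x = 0"
proof -
  have "(f ^^ (j - i)) ((f ^^ i) x) = 0" using assms(2) funpow_additive(2)[OF assms(1)] by metis
  moreover have "j = (j - i) + i" using assms(3) by simp
  ultimately show ?thesis by (metis comp_apply funpow_add)
qed

text \<open>
  The induction takes off one factor \<open>P + Q\<close>: it splits a vector into one that a smaller power of \<open>P\<close>
  kills and one that a smaller power of \<open>Q\<close> kills.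
\<close>
lemma nilpotent_sum:
  fixes P Q R :: "'a::ab_group_add \<Rightarrow> 'a"
  assumes P: "\<And>x y. P (x + y) = P x + P y" and Q: "\<And>x y. Q (x + y) = Q x + Q y"
    and comm: "\<And>x. P (Q x) = Q (P x)" and R: "\<And>x. R x = P x + Q x"
    and "(P ^^ p) x = 0" "(Q ^^ q) x = 0"
  shows "(R ^^ (p + q)) x = 0"
  using assms(5,6)
proof (induction "p + q" arbitrary: p q x)
  case 0
  then show ?case by simp
next
  case (Suc s)
  have Radd: "R (x + y) = R x + R y" for x y by (simp add: R P Q add_ac)
  have x0: "x = 0 \<Longrightarrow> (R ^^ n) x = 0" for n by (simp add: funpow_additive(2)[OF Radd])
  show ?case
  proof (cases "p = 0 \<or> q = 0")
    case True
    then show ?thesis using Suc.prems x0 by auto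
  next
    case False
    then obtain p' q' where pq: "p = Suc p'" "q = Suc q'" by (metis not0_implies_Suc)
    have "(P ^^ p') (P x) = 0" using Suc.prems(1) pq by (simp add: funpow_swap1)
    moreover have "(Q ^^ q) (P x) = 0"
      using Suc.prems(2) funpow_commute[of Q P q 1 x] comm P by (metis add.right_neutral add_left_cancel funpow_0 funpow_Suc_right comp_apply One_nat_def)
    moreover have "(Q ^^ q') (Q x) = 0" using Suc.prems(2) pq by (simp add: funpow_swap1)
    moreover have "(P ^^ p) (Q x) = 0"
      using Suc.prems(1) funpow_commute[of P Q p 1 x] comm Q by (metis add.right_neutral add_left_cancel funpow_0 funpow_Suc_right comp_apply One_nat_def)
    ultimately have "(R ^^ s) (P x) = 0" "(R ^^ s) (Q x) = 0"
      using Suc.hyps(1)[of p' q "P x"] Suc.hyps(1)[of p q' "Q x"] Suc.hyps(2) pq by simp_all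
    then have "(R ^^ s) (P x + Q x) = 0" using funpow_additive(1)[of R, OF Radd] by simp
    then have "(R ^^ s) (R x) = 0" using R by metis
    then show ?thesis using Suc.hyps(2) by (metis funpow_swap1 funpow.simps(2) comp_apply)
  qed
qed

section \<open>Formal distributions in three variables\<close>

type_synonym 'v modes3 = "int \<Rightarrow> int \<Rightarrow> int \<Rightarrow> 'v"

text \<open>
  Coefficients of formal distributions \<open>F(z,w,u)\<close> in three variables, indexed as in the two-variable
  case. The operators \<open>d12\<close>, \<open>d13\<close>, \<open>d23\<close> are the multiplications by \<open>z - w\<close>, \<open>z - u\<close> and \<open>w - u\<close>.
\<close>
definition d12 :: "'v::ab_group_add modes3 \<Rightarrow> 'v modes3" where
  "d12 F = (\<lambda>k m n. F (k + 1) m n - F k (m + 1) n)"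

definition d13 :: "'v::ab_group_add modes3 \<Rightarrow> 'v modes3" where
  "d13 F = (\<lambda>k m n. F (k + 1) m n - F k m (n + 1))"

definition d23 :: "'v::ab_group_add modes3 \<Rightarrow> 'v modes3" where
  "d23 F = (\<lambda>k m n. F k (m + 1) n - F k m (n + 1))"

lemma d_additive:
  "d12 (F + G) = d12 F + d12 G" "d13 (F + G) = d13 F + d13 G" "d23 (F + G) = d23 F + d23 G"
  by (simp_all add: d12_def d13_def d23_def fun_eq_iff)

lemma d_commute:
  "d12 (d13 F) = d13 (d12 F)" "d12 (d23 F) = d23 (d12 F)" "d13 (d23 F) = d23 (d13 F)"
  by (simp_all add: d12_def d13_def d23_def fun_eq_iff algebra_simps)

text \<open>
  Dong's lemma: \<open>w - u\<close> is the sum of \<open>w - z\<close> and \<open>z - u\<close>, and suitable powers of both kill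
  \<open>(w - u)\<^sup>N G\<close>.
\<close>
lemma dong_locality:
  assumes "(d12 ^^ M) G = 0" "(d13 ^^ N) ((d23 ^^ N) G) = 0"
  shows "(d23 ^^ (M + N + N)) G = 0"
proof -
  let ?F = "(d23 ^^ N) G"
  have "((\<lambda>F. - d12 F) ^^ i) F = (if even i then (d12 ^^ i) F else - (d12 ^^ i) F)" for i and F :: "'a modes3"
  proof -
    have "d12 (- F) = - d12 F" for F :: "'a modes3" by (simp add: d12_def fun_eq_iff)
    then show ?thesis by (induction i) auto
  qed
  moreover have "(d12 ^^ M) ?F = 0"
    using funpow_commute[of d12 d23 M N G, OF d_commute(2)] assms(1)
      funpow_additive(2)[of d23 N, OF d_additive(3)] by simp
  ultimately have 1: "((\<lambda>F. - d12 F) ^^ M) ?F = 0" by simp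
  have "d13 (- F) = - d13 F" for F :: "'a modes3" by (simp add: d13_def fun_eq_iff)
  then have comm: "- d12 (d13 F) = d13 (- d12 F)" for F :: "'a modes3" by (simp add: d_commute)
  have R: "d23 F = - d12 F + d13 F" for F :: "'a modes3"
    by (simp add: d12_def d13_def d23_def fun_eq_iff)
  have "(d23 ^^ (M + N)) ?F = 0"
    by (rule nilpotent_sum[of "\<lambda>F. - d12 F" d13, OF _ _ comm R 1 assms(2)]) (simp_all add: d_additive)
  then show ?thesis by (simp add: funpow_add)
qed

text \<open>
  A three-variable distribution is often built from a two-variable one, with the third variable in
  the vector to which it is applied or in a linear map that is applied to the result. The
  following rules reduce powers of \<open>d12\<close>, \<open>d13\<close>, \<open>d23\<close> to powers of the two-variable operator.
\<close>
lemma d13_pow: "(d13 ^^ N) (\<lambda>k m n. F k n (g m)) = (\<lambda>k m n. (times_z_minus_w ^^ N) F k n (g m))"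
  by (induction N) (simp_all add: d13_def times_z_minus_w_def)

lemma d12_pow: "(d12 ^^ N) (\<lambda>k m n. F k m (g n)) = (\<lambda>k m n. (times_z_minus_w ^^ N) F k m (g n))"
  by (induction N) (simp_all add: d12_def times_z_minus_w_def)

lemma d23_pow_slice: "(d23 ^^ N) F k m n = (times_z_minus_w ^^ N) (\<lambda>m n v. F k m n) m n v"
  by (induction N arbitrary: m n) (simp_all add: d23_def times_z_minus_w_def)

lemma d12_pow_outer:
  assumes "\<And>n x y. f n (x - y) = f n x - f n y"
  shows "(d12 ^^ N) (\<lambda>k m n. f n (F k m v)) = (\<lambda>k m n. f n ((times_z_minus_w ^^ N) F k m v))"
  by (induction N) (simp_all add: d12_def times_z_minus_w_def assms)

lemma d23_pow_outer:
  assumes "\<And>n x y. f n (x - y) = f n x - f n y"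
  shows "(d23 ^^ N) (\<lambda>k m n. f k (F m n v)) = (\<lambda>k m n. f k ((times_z_minus_w ^^ N) F m n v))"
  by (induction N) (simp_all add: d23_def times_z_minus_w_def assms)

lemma times_z_minus_w_add: "times_z_minus_w (F + G) = times_z_minus_w F + times_z_minus_w G"
  by (simp add: times_z_minus_w_def fun_eq_iff)

text \<open>
  Such an \<open>R\<close> is constant on each antidiagonal, which reaches the region where it vanishes.
\<close>
lemma antidiagonal_vanish:
  assumes "\<And>k m. R (k + 1) m = R k (m + 1)" and "\<And>k m. m \<ge> (L::int) \<Longrightarrow> R k m = 0"
  shows "R (k::int) m = (0::'a::zero)"
proof -
  have "R k m = R (k - int i) (m + int i)" for i
  proof (induction i)
    case (Suc i)
    then show ?case using assms(1)[of "k - int (Suc i)" "m + int i"] by (simp add: algebra_simps)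
  qed simp
  from this[of "nat (L - m)"] show ?thesis using assms(2) by simp
qed

text \<open>
  On these distributions, whose coefficients vanish for large mode index of \<open>w\<close> uniformly in that of
  \<open>z\<close>, multiplication by \<open>z - w\<close> is injective. Identities between infinite sums of modes can then be checked
  after multiplication by \<open>z - w\<close>, which makes the sums collapse.
\<close>
definition truncated_second :: "'v::ab_group_add modes3 \<Rightarrow> bool" where
  "truncated_second F \<longleftrightarrow> (\<forall>n. \<exists>L. \<forall>k. \<forall>m\<ge>L. F k m n = 0)"

lemma truncated_second_d13: "truncated_second F \<Longrightarrow> truncated_second (d13 F)"
  unfolding truncated_second_def d13_def
proof
  fix n assume *: "\<forall>n. \<exists>L. \<forall>k. \<forall>m\<ge>L. F k m n = 0"
  obtain L1 L2 where "\<forall>k. \<forall>m\<ge>L1. F k m n = 0" "\<forall>k. \<forall>m\<ge>L2. F k m (n + 1) = 0" using * by meson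
  then show "\<exists>L. \<forall>k. \<forall>m\<ge>L. F (k + 1) m n - F k m (n + 1) = 0"
    by (intro exI[of _ "max L1 L2"]) simp
qed

lemma truncated_second_d23: "truncated_second F \<Longrightarrow> truncated_second (d23 F)"
  unfolding truncated_second_def d23_def
proof
  fix n assume *: "\<forall>n. \<exists>L. \<forall>k. \<forall>m\<ge>L. F k m n = 0"
  obtain L1 L2 where "\<forall>k. \<forall>m\<ge>L1. F k m n = 0" "\<forall>k. \<forall>m\<ge>L2. F k m (n + 1) = 0" using * by meson
  then show "\<exists>L. \<forall>k. \<forall>m\<ge>L. F k (m + 1) n - F k m (n + 1) = 0"
    by (intro exI[of _ "max L1 L2"]) simp
qed

lemma truncated_second_zero:
  assumes "truncated_second F" "d12 F = 0" shows "F = 0"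
proof -
  have "F k m n = 0" for k m n
  proof -
    obtain L where L: "\<And>k m. m \<ge> L \<Longrightarrow> F k m n = 0"
      using assms(1) unfolding truncated_second_def by blast
    have "d12 F k m n = 0" for k m using assms(2) by simp
    then have "F (k + 1) m n = F k (m + 1) n" for k m unfolding d12_def by simp
    then show ?thesis by (rule antidiagonal_vanish[of "\<lambda>k m. F k m n" L, OF _ L])
  qed
  then show ?thesis by (simp add: fun_eq_iff)
qed

lemma d13_pow_swap: "(d13 ^^ N) (\<lambda>k m n. F m k n) = (\<lambda>k m n. (d23 ^^ N) F m k n)"
proof (induction N)
  case (Suc N)
  show ?case unfolding funpow.simps comp_def Suc unfolding d13_def d23_def ..
qed simp

lemma d23_pow_swap: "(d23 ^^ N) (\<lambda>k m n. F m k n) = (\<lambda>k m n. (d13 ^^ N) F m k n)"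
proof (induction N)
  case (Suc N)
  show ?case unfolding funpow.simps comp_def Suc unfolding d13_def d23_def ..
qed simp

lemma d12_pow_commute: "d12 ((d13 ^^ N) F) = (d13 ^^ N) (d12 F)" "d12 ((d23 ^^ N) F) = (d23 ^^ N) (d12 F)"
  using funpow_commute[of d12 d13 1 N F, OF d_commute(1)] funpow_commute[of d12 d23 1 N F, OF d_commute(2)]
  by simp_all

text \<open>
  The hypothesis of Dong's lemma when \<open>F(z,w,u)\<close> is the commutator of a product of fields at \<open>z\<close> and \<open>w\<close>
  with a field at \<open>u\<close>.
\<close>
definition local_in_third :: "'v::ab_group_add modes3 \<Rightarrow> bool" where
  "local_in_third F \<longleftrightarrow> (\<exists>N. (d13 ^^ N) ((d23 ^^ N) F) = 0)"

lemma local_in_third_mono: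
  assumes "(d13 ^^ i) ((d23 ^^ i) F) = 0" "i \<le> N"
  shows "(d13 ^^ N) ((d23 ^^ N) F) = 0"
proof -
  have "(d13 ^^ N) ((d23 ^^ i) F) = 0" by (rule funpow_vanish_mono[OF d_additive(2) assms])
  then have "(d23 ^^ i) ((d13 ^^ N) F) = 0"
    using funpow_commute[of d13 d23 N i F, OF d_commute(3)] by simp
  then have "(d23 ^^ N) ((d13 ^^ N) F) = 0" by (rule funpow_vanish_mono[OF d_additive(3) _ assms(2)])
  then show ?thesis using funpow_commute[of d13 d23 N N F, OF d_commute(3)] by simp
qed

lemma local_in_third_add:
  assumes "local_in_third F" "local_in_third G" shows "local_in_third (F + G)" "local_in_third (F - G)"
proof -
  obtain N1 N2 where "(d13 ^^ N1) ((d23 ^^ N1) F) = 0" "(d13 ^^ N2) ((d23 ^^ N2) G) = 0"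
    using assms unfolding local_in_third_def by blast
  then have "(d13 ^^ (N1 + N2)) ((d23 ^^ (N1 + N2)) F) = 0" "(d13 ^^ (N1 + N2)) ((d23 ^^ (N1 + N2)) G) = 0"
    by (auto intro: local_in_third_mono)
  then show "local_in_third (F + G)" "local_in_third (F - G)"
    unfolding local_in_third_def
    by (auto simp: funpow_additive(1,3)[of d23, OF d_additive(3)] funpow_additive(1,3)[of d13, OF d_additive(2)]
        intro!: exI[of _ "N1 + N2"])
qed

lemma local_in_third_swap:
  assumes "local_in_third F" shows "local_in_third (\<lambda>k m n. F m k n)"
proof -
  obtain N where "(d13 ^^ N) ((d23 ^^ N) F) = 0" using assms unfolding local_in_third_def by blast
  then have "(d23 ^^ N) ((d13 ^^ N) F) = 0" using funpow_commute[of d13 d23 N N F, OF d_commute(3)] by simp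
  then have "(d13 ^^ N) ((d23 ^^ N) (\<lambda>k m n. F m k n)) = 0"
    unfolding d23_pow_swap[of N F] d13_pow_swap[of N "(d13 ^^ N) F"] by (simp add: fun_eq_iff)
  then show ?thesis unfolding local_in_third_def by blast
qed

lemma local_in_third_d12: "local_in_third F \<Longrightarrow> local_in_third ((d12 ^^ i) F)"
proof -
  assume "local_in_third F"
  then obtain N where N: "(d13 ^^ N) ((d23 ^^ N) F) = 0" unfolding local_in_third_def by blast
  have "(d13 ^^ N) ((d23 ^^ N) ((d12 ^^ i) F)) = (d12 ^^ i) ((d13 ^^ N) ((d23 ^^ N) F))"
    unfolding funpow_commute[of d12 d13, OF d_commute(1)] funpow_commute[of d12 d23, OF d_commute(2)] ..
  then show ?thesis
    unfolding local_in_third_def N funpow_additive(2)[of d12, OF d_additive(1)] by blast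
qed

section \<open>Linear algebra\<close>

lemma (in vector_space) span_map_mem:
  assumes "v \<in> span S" "\<And>x. x \<in> S \<Longrightarrow> f x \<in> U" "subspace U"
    and "\<And>x y. f (x + y) = f x + f y" "\<And>c x. f (scale c x) = scale c (f x)"
  shows "f v \<in> U"
  using assms(1)
proof (induction rule: span_induct_alt)
  case base
  then show ?case using assms(5)[of 0 0] subspace_0[OF assms(3)] by simp
next
  case (step c x y)
  then show ?case using assms by (simp add: subspace_add subspace_scale)
qed

text \<open>
  As a function of \<open>n\<close>, the coefficient of \<open>y i\<close> is a polynomial of degree \<open>i\<close>. The difference of two
  consecutive combinations is a system of the same form in \<open>y 1, y 2, \<dots>\<close> with one equation less and
  with \<open>p\<close> increased by one.
\<close>
lemma (in vector_space) binomial_system_mem: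
  assumes U: "subspace U"
    and "\<And>n. p \<le> n \<Longrightarrow> n < p + L \<Longrightarrow> (\<Sum>i<L. scale (of_nat ((n + i) choose i)) (y i)) \<in> U"
    and "i < L"
  shows "y i \<in> U"
  using assms(2,3)
proof (induction L arbitrary: p y i)
  case (Suc L)
  let ?R = "\<lambda>n. \<Sum>i<Suc L. scale (of_nat ((n + i) choose i)) (y i)"
  have tail: "y (Suc i) \<in> U" if "i < L" for i
  proof (rule Suc.IH[of "Suc p" "\<lambda>i. y (Suc i)", OF _ that])
    fix n assume n: "Suc p \<le> n" "n < Suc p + L"
    then obtain n' where n': "n = Suc n'" by (cases n) auto
    have "?R n - ?R n' = (\<Sum>i<L. scale (of_nat ((n + i) choose i)) (y (Suc i)))"
      unfolding sum.lessThan_Suc_shift n'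
      by (simp add: sum_subtractf[symmetric] scale_left_diff_distrib[symmetric])
    moreover have "?R n - ?R n' \<in> U"
      using n n' by (intro subspace_diff[OF U] Suc.prems(1)) auto
    ultimately show "(\<Sum>i<L. scale (of_nat ((n + i) choose i)) (y (Suc i))) \<in> U" by simp
  qed
  have "y 0 = ?R p - (\<Sum>i<L. scale (of_nat ((p + Suc i) choose (Suc i))) (y (Suc i)))"
    unfolding sum.lessThan_Suc_shift by simp
  moreover have "?R p \<in> U" by (rule Suc.prems(1)) auto
  moreover have "(\<Sum>i<L. scale (of_nat ((p + Suc i) choose (Suc i))) (y (Suc i))) \<in> U"
    by (intro subspace_sum[OF U] subspace_scale[OF U]) (use tail in auto)
  ultimately have "y 0 \<in> U" using subspace_diff[OF U] by simp
  with tail Suc.prems(2) show ?case by (cases i) auto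
qed simp

text \<open>
  Here \<open>a\<close> is the largest index in a linear combination. The vectors \<open>g a\<close> may be dependent, so \<open>a\<close> is not
  determined by \<open>v\<close>.
\<close>
lemma (in vector_space) span_leading:
  fixes g :: "'i::linorder \<Rightarrow> 'b"
  assumes "v \<in> span (B \<union> g ` X)"
  shows "v \<in> span B \<or> (\<exists>a\<in>X. v \<in> span (insert (g a) (B \<union> g ` {b \<in> X. b < a})))"
  using assms
proof (induction rule: span_induct_alt)
  case base
  then show ?case by (simp add: span_zero)
next
  case (step c u v)
  let ?S = "\<lambda>a. insert (g a) (B \<union> g ` {b \<in> X. b < a})"
  have S_mono: "span (?S a) \<subseteq> span (?S b)" if "a \<le> b" "a \<in> X" for a b
    by (rule span_mono) (use that in \<open>auto simp: order.strict_iff_order intro: order_trans\<close>)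
  have B: "span B \<subseteq> span (?S a)" for a by (rule span_mono) auto
  have comb: "scale c u + v \<in> span (?S a)" if "u \<in> span (?S a)" "v \<in> span (?S a)" for a
    using that by (intro span_add span_scale)
  show ?case
  proof (cases "u \<in> B")
    case True
    then have u: "u \<in> span B" by (rule span_base)
    from step(2) show ?thesis
    proof
      assume "v \<in> span B"
      then show ?thesis using u by (intro disjI1 span_add span_scale)
    next
      assume "\<exists>a\<in>X. v \<in> span (?S a)"
      then obtain a where "a \<in> X" "v \<in> span (?S a)" by blast
      then show ?thesis using comb[of a] u B[of a] by blast
    qed
  next
    case False
    then obtain a where a: "a \<in> X" "u = g a" using step(1) by blast
    then have u: "u \<in> span (?S a)" by (intro span_base) simp
    from step(2) show ?thesis
    proof
      assume "v \<in> span B"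
      then show ?thesis using comb[of a] u B[of a] a(1) by blast
    next
      assume "\<exists>a\<in>X. v \<in> span (?S a)"
      then obtain b where b: "b \<in> X" "v \<in> span (?S b)" by blast
      show ?thesis
      proof (cases "a \<le> b")
        case True
        then show ?thesis using comb[of b] u b S_mono[OF True a(1)] by blast
      next
        case False
        then show ?thesis using comb[of a] u b a(1) S_mono[of b a] by fastforce
      qed
    qed
  qed
qed

section \<open>Dickson's lemma\<close>

text \<open>
  There is a monotone subsequence, and a nonincreasing sequence of natural numbers is constant from
  the place on where it is minimal.
\<close>
lemma nat_nondecreasing_subsequence:
  fixes s :: "nat \<Rightarrow> nat"
  obtains g :: "nat \<Rightarrow> nat" where "strict_mono g" "mono (\<lambda>n. s (g n))"
proof -
  obtain g where g: "strict_mono g" "monoseq (\<lambda>n. s (g n))" using seq_monosub by blast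
  show ?thesis
  proof (cases "mono (\<lambda>n. s (g n))")
    case False
    then have dec: "s (g n) \<le> s (g m)" if "m \<le> n" for m n
      using g(2) that unfolding monoseq_iff mono_def decseq_def by blast
    obtain N where N: "\<And>n. s (g N) \<le> s (g n)"
      using ex_has_least_nat[of "\<lambda>_. True" 0 "\<lambda>n. s (g n)"] by auto
    have "s (g (N + n)) = s (g N)" for n
      using dec[of N "N + n"] N[of "N + n"] by simp
    then show ?thesis
      using g(1) by (intro that[of "\<lambda>n. g (N + n)"]) (auto simp: strict_mono_def mono_def)
  qed (use g(1) that in blast)
qed

text \<open>
  Passing to subsequences for one element of \<open>{..<r}\<close> after the other makes all multiplicities
  nondecreasing.
\<close>
lemma dickson:
  fixes f :: "nat \<Rightarrow> nat multiset"
  assumes "\<And>n. set_mset (f n) \<subseteq> {..<r}"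
  obtains i j where "i < j" "f i \<subseteq># f j"
proof -
  have "\<exists>g::nat \<Rightarrow> nat. strict_mono g \<and> (\<forall>k<q. mono (\<lambda>n. count (f (g n)) k))" for q
  proof (induction q)
    case 0
    show ?case by (intro exI[of _ id]) (simp add: strict_mono_def)
  next
    case (Suc q)
    then obtain g :: "nat \<Rightarrow> nat" where g: "strict_mono g" "\<And>k. k < q \<Longrightarrow> mono (\<lambda>n. count (f (g n)) k)" by blast
    obtain h :: "nat \<Rightarrow> nat" where h: "strict_mono h" "mono (\<lambda>n. count (f (g (h n))) q)"
      by (rule nat_nondecreasing_subsequence)
    have "mono (\<lambda>n. count (f (g (h n))) k)" if "k < Suc q" for k
      using that h g(2)[of k] strict_mono_mono[OF h(1)] by (cases "k = q") (auto simp: mono_def)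
    moreover have "strict_mono (\<lambda>n. g (h n))" using g(1) h(1) by (simp add: strict_mono_def)
    ultimately show ?case by (intro exI[of _ "\<lambda>n. g (h n)"]) blast
  qed
  then obtain g :: "nat \<Rightarrow> nat" where g: "strict_mono g" "\<And>k. k < r \<Longrightarrow> mono (\<lambda>n. count (f (g n)) k)" by blast
  have "f (g 0) \<subseteq># f (g 1)"
  proof (rule mset_subset_eqI)
    fix k
    show "count (f (g 0)) k \<le> count (f (g 1)) k"
    proof (cases "k < r")
      case True
      then show ?thesis using g(2)[of k] by (simp add: mono_def)
    next
      case False
      then have "k \<notin># f (g 0)" using assms[of "g 0"] by auto
      then show ?thesis by (simp add: not_in_iff)
    qed
  qed
  moreover have "g 0 < g 1" using g(1) by (simp add: strict_mono_def)
  ultimately show ?thesis by (rule that[rotated])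
qed

text \<open>
  If the chain grew forever, one could pick a new multiset at each growth; by Dickson's lemma one of
  them contains an earlier one and so was not new.
\<close>
lemma upward_closed_chain_stabilizes:
  fixes U :: "nat \<Rightarrow> nat multiset set"
  assumes sub: "\<And>n M. M \<in> U n \<Longrightarrow> set_mset M \<subseteq> {..<r}"
    and up: "\<And>n M M'. M \<in> U n \<Longrightarrow> M \<subseteq># M' \<Longrightarrow> set_mset M' \<subseteq> {..<r} \<Longrightarrow> M' \<in> U n"
    and chain: "\<And>n. U n \<subseteq> U (Suc n)"
  shows "\<exists>N. \<forall>n\<ge>N. U n = U N"
proof (rule ccontr)
  assume unstable: "\<nexists>N. \<forall>n\<ge>N. U n = U N"
  have mono: "U m \<subseteq> U n" if "m \<le> n" for m n by (rule lift_Suc_mono_le[of U, OF chain that])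
  have "\<exists>n M. N \<le> n \<and> M \<in> U n \<and> M \<notin> U N" for N
  proof -
    obtain n where "N \<le> n" "U n \<noteq> U N" using unstable by blast
    then show ?thesis using mono[of N n] by blast
  qed
  then obtain next_index new where step: "\<And>N. N \<le> next_index N" "\<And>N. new N \<in> U (next_index N)" "\<And>N. new N \<notin> U N"
    by metis
  (* the new element picked at stage k i is present from stage k (i + 1) on *)
  define k where "k i = (next_index ^^ i) 0" for i
  have k_Suc: "k (Suc i) = next_index (k i)" for i by (simp add: k_def)
  have k_mono: "k i \<le> k j" if "i \<le> j" for i j
    by (rule lift_Suc_mono_le[of k, OF _ that]) (simp add: k_Suc step(1))
  have new_sub: "set_mset (new N) \<subseteq> {..<r}" for N by (rule sub[OF step(2)])
  obtain i j where ij: "i < j" "new (k i) \<subseteq># new (k j)"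
    by (rule dickson[of "\<lambda>i. new (k i)" r, OF new_sub])
  have "new (k i) \<in> U (k (Suc i))" using step(2) by (simp add: k_Suc)
  then have "new (k i) \<in> U (k j)" using mono[OF k_mono[of "Suc i" j]] ij(1) by auto
  then have "new (k j) \<in> U (k j)" by (rule up[OF _ ij(2) new_sub])
  then show False using step(3) by blast
qed

section \<open>The vacuum determines a local field\<close>

context vertex_algebra
begin

lemma Y_left:
  "Y (a + b) j c = Y a j c + Y b j c" "Y (a - b) j c = Y a j c - Y b j c" "Y (scale r a) j c = scale r (Y a j c)"
  "Y 0 j c = 0" "Y (sum f A) j c = (\<Sum>x\<in>A. Y (f x) j c)"
proof -
  interpret L: Vector_Spaces.linear scale scale "\<lambda>a. Y a j c" by (rule Y_linear_left)
  show  "Y (a + b) j c = Y a j c + Y b j c" "Y (a - b) j c = Y a j c - Y b j c" "Y (scale r a) j c = scale r (Y a j c)"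
  "Y 0 j c = 0" "Y (sum f A) j c = (\<Sum>x\<in>A. Y (f x) j c)"
    by (rule L.add L.diff L.scale L.zero L.sum)+
qed

lemma Y_right:
  "Y c j (a + b) = Y c j a + Y c j b" "Y c j (a - b) = Y c j a - Y c j b" "Y c j (scale r a) = scale r (Y c j a)"
  "Y c j 0 = 0" "Y c j (sum f A) = (\<Sum>x\<in>A. Y c j (f x))"
proof -
  interpret L: Vector_Spaces.linear scale scale "\<lambda>a. Y c j a" by (rule Y_linear_right)
  show "Y c j (a + b) = Y c j a + Y c j b" "Y c j (a - b) = Y c j a - Y c j b" "Y c j (scale r a) = scale r (Y c j a)"
  "Y c j 0 = 0" "Y c j (sum f A) = (\<Sum>x\<in>A. Y c j (f x))"
    by (rule L.add L.diff L.scale L.zero L.sum)+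
qed

lemma T_simps:
  "T (a + b) = T a + T b" "T (a - b) = T a - T b" "T (scale r a) = scale r (T a)"
  "T 0 = 0" "T (sum f A) = (\<Sum>x\<in>A. T (f x))"
proof -
  interpret L: Vector_Spaces.linear scale scale T by (rule T_linear)
  show "T (a + b) = T a + T b" "T (a - b) = T a - T b" "T (scale r a) = scale r (T a)"
  "T 0 = 0" "T (sum f A) = (\<Sum>x\<in>A. T (f x))"
    by (rule L.add L.diff L.scale L.zero L.sum)+
qed

lemma T_vac: "T vac = 0"
  using translation_derivative[of vac "-1" vac] vacuum_creation[of "T vac"] by (simp add: vacuum_left)

lemma times_z_minus_w_pow:
  "(times_z_minus_w ^^ N) F m n v
    = (\<Sum>j\<le>N. scale ((-1) ^ j * of_nat (N choose j)) (F (m + int N - int j) (n + int j) v))"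
proof (induction N arbitrary: m n)
  case 0
  then show ?case by simp
next
  case (Suc N)
  let ?G = "\<lambda>j. F (m + int (Suc N) - int j) (n + int j) v"
  have A: "(times_z_minus_w ^^ N) F (m + 1) n v
      = (\<Sum>j\<le>Suc N. scale ((-1) ^ j * of_nat (N choose j)) (?G j))"
    by (simp add: Suc algebra_simps)
  have B: "(times_z_minus_w ^^ N) F m (n + 1) v
      = (\<Sum>j\<le>N. scale ((-1) ^ j * of_nat (N choose j)) (?G (Suc j)))"
    unfolding Suc by (rule sum.cong) (simp_all add: algebra_simps)
  have "(times_z_minus_w ^^ Suc N) F m n v
     = ?G 0 + (\<Sum>j\<le>N. scale ((-1) ^ Suc j * of_nat (N choose Suc j)) (?G (Suc j)))
       - (\<Sum>j\<le>N. scale ((-1) ^ j * of_nat (N choose j)) (?G (Suc j)))"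
    unfolding funpow.simps comp_def times_z_minus_w_def[of "(times_z_minus_w ^^ N) F"] A B sum.atMost_Suc_shift by simp
  also have "\<dots> = ?G 0 + (\<Sum>j\<le>N. scale ((-1) ^ Suc j * of_nat (Suc N choose Suc j)) (?G (Suc j)))"
    unfolding diff_conv_add_uminus add.assoc sum_negf[symmetric] sum.distrib[symmetric]
    by (intro arg_cong2[of _ _ _ _ plus] sum.cong refl) (simp add: algebra_simps)
  also have "\<dots> = (\<Sum>j\<le>Suc N. scale ((-1) ^ j * of_nat (Suc N choose j)) (?G j))"
    unfolding sum.atMost_Suc_shift by simp
  finally show ?case .
qed

abbreviation commutator_modes :: "'v \<Rightarrow> 'v \<Rightarrow> int \<Rightarrow> int \<Rightarrow> 'v \<Rightarrow> 'v" where
  "commutator_modes a b \<equiv> (\<lambda>k m v. Y a k (Y b m v) - Y b m (Y a k v))"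

lemma locality_exponent:
  obtains N where "(times_z_minus_w ^^ N) (commutator_modes a b) = 0"
  using locality[of a b] by (auto simp: zero_fun_def)

text \<open>
  Locality of \<open>A(z)\<close> and \<open>Y(c,w)\<close>, applied to the vacuum, at \<open>w = 0\<close>: on one side only \<open>A(z)c\<close> survives, since
  \<open>Y(c,w)vac\<close> is regular with constant term \<open>c\<close>, and the other side depends on \<open>A(z)vac\<close> only.
\<close>
lemma field_from_vacuum:
  assumes "(times_z_minus_w ^^ N) (\<lambda>m n v. A m (Y c n v) - Y c n (A m v)) (m - int N) (- 1) vac = 0"
    and "\<And>m. A m 0 = 0"
  shows "A m c = (\<Sum>j\<le>N. scale ((-1) ^ j * of_nat (N choose j)) (Y c (int j - 1) (A (m - int j) vac)))"
proof -
  have 1: "(\<Sum>j\<le>N. scale ((-1) ^ j * of_nat (N choose j)) (A (m - int j) (Y c (int j - 1) vac))) = A m c"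
  proof -
    have "(\<Sum>j\<le>N. scale ((-1) ^ j * of_nat (N choose j)) (A (m - int j) (Y c (int j - 1) vac)))
      = (\<Sum>j\<in>{0}. scale ((-1) ^ j * of_nat (N choose j)) (A (m - int j) (Y c (int j - 1) vac)))"
      by (rule sum.mono_neutral_right) (auto simp: vacuum_regular assms(2))
    then show ?thesis by (simp add: vacuum_creation)
  qed
  have "(\<Sum>j\<le>N. scale ((-1) ^ j * of_nat (N choose j)) (A (m - int j) (Y c (int j - 1) vac)))
     - (\<Sum>j\<le>N. scale ((-1) ^ j * of_nat (N choose j)) (Y c (int j - 1) (A (m - int j) vac))) = 0"
    using assms(1) unfolding times_z_minus_w_pow sum_subtractf[symmetric] by (simp add: algebra_simps)
  then show ?thesis unfolding 1 by simp
qed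

text \<open>
  For \<open>m = -1\<close> the summand \<open>j = 0\<close> is \<open>c\<^bsub>(-1)\<^esub> a\<close>, and the others are nonnegative modes of \<open>c\<close> applied to
  multiples of derivatives of \<open>a\<close>. This much of the skew-symmetry \<open>Y(a,z)c = e\<^sup>z\<^sup>T Y(c,-z)a\<close> suffices below.
\<close>
lemma skew_symmetry_weak:
  obtains N where "\<And>m. Y a m c =
    (\<Sum>j\<le>N. scale ((-1) ^ j * of_nat (N choose j)) (Y c (int j - 1) (Y a (m - int j) vac)))"
proof -
  obtain N where "(times_z_minus_w ^^ N) (commutator_modes a c) = 0" by (rule locality_exponent)
  then have "Y a m c =
    (\<Sum>j\<le>N. scale ((-1) ^ j * of_nat (N choose j)) (Y c (int j - 1) (Y a (m - int j) vac)))" for m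
    by (intro field_from_vacuum) (simp_all add: Y_right)
  then show ?thesis by (rule that)
qed

text \<open>
  The distribution \<open>Q(z,w)\<close> stands for a combination of products of two fields at \<open>z\<close> and \<open>w\<close>, such as
  \<open>(z-w)\<^sup>n\<close> times their commutator, and \<open>Q 0 m\<close> are the modes of its residue in \<open>z\<close>. By Dong's
  lemma this residue is local with all fields. Translation covariance determines its values on the
  vacuum from the single vector \<open>x\<close>, and these values determine it.
\<close>
lemma field_uniqueness:
  assumes Q0: "\<And>k m. Q k m 0 = 0"
    and loc12: "(times_z_minus_w ^^ M) Q = 0"
    and loc: "\<And>c. \<exists>N. (d13 ^^ N) ((d23 ^^ N) (\<lambda>k m n. Q k m (Y c n vac) - Y c n (Q k m vac))) = 0"
    and trans: "\<And>m. T (Q 0 m vac) = scale (of_int (- m)) (Q 0 (m - 1) vac)"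
    and reg: "\<And>m. m \<ge> 0 \<Longrightarrow> Q 0 m vac = 0"
    and cre: "Q 0 (-1) vac = x"
  shows "Q 0 m c = Y x m c"
proof -
  have vac_eq: "Q 0 m vac = Y x m vac" for m
  proof (cases "m \<ge> 0")
    case False
    have "Q 0 (- 1 - int i) vac = Y x (- 1 - int i) vac" for i
    proof (induction i)
      case 0
      then show ?case by (simp add: cre vacuum_creation)
    next
      case (Suc i)
      let ?c = "of_int (- (- 1 - int i)) :: complex"
      have "scale ?c (Q 0 (- 1 - int i - 1) vac) = scale ?c (Y x (- 1 - int i - 1) vac)"
        using trans[of "- 1 - int i"] translation_commutator[of x "- 1 - int i" vac] Suc
        by (simp only: T_vac Y_right diff_zero)
      moreover have "?c \<noteq> 0" by (simp only: of_int_eq_0_iff)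
      ultimately have "Q 0 (- 1 - int i - 1) vac = Y x (- 1 - int i - 1) vac"
        by (metis scale_cancel_left)
      then show ?case by (simp add: algebra_simps)
    qed
    from this[of "nat (- 1 - m)"] False show ?thesis by simp
  qed (simp add: reg vacuum_regular)
  let ?G = "\<lambda>k m n. Q k m (Y c n vac) - Y c n (Q k m vac)"
  obtain N where N: "(d13 ^^ N) ((d23 ^^ N) ?G) = 0" using loc by blast
  obtain P where P: "(times_z_minus_w ^^ P) (commutator_modes x c) = 0" by (rule locality_exponent)
  have "(d12 ^^ M) ?G = (d12 ^^ M) ((\<lambda>k m n. Q k m (Y c n vac)) - (\<lambda>k m n. Y c n (Q k m vac)))"
    by (rule arg_cong[of _ _ "d12 ^^ M"]) (simp add: fun_eq_iff)
  also have "\<dots> = 0"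
    unfolding funpow_additive(3)[of d12, OF d_additive(1)] d12_pow[of _ Q "\<lambda>n. Y c n vac"]
      d12_pow_outer[of "\<lambda>n. Y c n", OF Y_right(2)] loc12 by (simp add: fun_eq_iff Y_right)
  finally have "(d12 ^^ M) ?G = 0" .
  from dong_locality[OF this N] have G: "(d23 ^^ (M + N + N)) ?G = 0" .
  let ?R = "(M + N + N) + P"
  have "(times_z_minus_w ^^ ?R) (\<lambda>m n v. Q 0 m (Y c n v) - Y c n (Q 0 m v)) p q vac = 0" for p q
  proof -
    have "(d23 ^^ ?R) ?G = 0" by (rule funpow_vanish_mono[OF d_additive(3) G]) simp
    then have "(d23 ^^ ?R) ?G 0 p q = 0" by (simp add: fun_eq_iff)
    then show ?thesis unfolding d23_pow_slice[of _ _ _ _ _ vac] times_z_minus_w_pow .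
  qed
  moreover have "(times_z_minus_w ^^ ?R) (commutator_modes x c) p q vac = 0" for p q
  proof -
    have "(times_z_minus_w ^^ ?R) (commutator_modes x c) = 0"
      by (rule funpow_vanish_mono[OF times_z_minus_w_add P]) simp
    then show ?thesis by (simp add: fun_eq_iff)
  qed
  ultimately show ?thesis
    using field_from_vacuum[of ?R "\<lambda>m. Q 0 m" c m] field_from_vacuum[of ?R "\<lambda>m. Y x m" c m] Q0 vac_eq
    by (simp add: Y_right)
qed

section \<open>Modes of products\<close>

lemma translation_product:
  "T (Y a k (Y b m v)) - Y a k (Y b m (T v)) = scale (of_int (- m)) (Y a k (Y b (m - 1) v))
      + scale (of_int (- k)) (Y a (k - 1) (Y b m v))"
proof -
  have "T (Y a k (Y b m v)) = Y a k (T (Y b m v)) + scale (of_int (- k)) (Y a (k - 1) (Y b m v))"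
    using translation_commutator[of a k "Y b m v"] by (simp only: diff_eq_eq add.commute)
  moreover have "T (Y b m v) = Y b m (T v) + scale (of_int (- m)) (Y b (m - 1) v)"
    using translation_commutator[of b m v] by (simp only: diff_eq_eq add.commute)
  ultimately show ?thesis by (simp only: Y_right) (simp add: algebra_simps)
qed

text \<open>
  The commutator is \<open>Y(a,z)[Y(b,w), Y(c,u)] + [Y(a,z), Y(c,u)]Y(b,w)\<close>; a power of \<open>w - u\<close> kills the first summand
  and a power of \<open>z - u\<close> kills the second.
\<close>
lemma commutators_local:
  "local_in_third (\<lambda>k m n. Y a k (Y b m (Y c n v)) - Y c n (Y a k (Y b m v)))"
proof -
  obtain N1 where N1: "(times_z_minus_w ^^ N1) (commutator_modes b c) = 0" by (rule locality_exponent)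
  obtain N2 where N2: "(times_z_minus_w ^^ N2) (commutator_modes a c) = 0" by (rule locality_exponent)
  define N where "N = max N1 N2"
  have bc: "(times_z_minus_w ^^ N) (commutator_modes b c) = 0"
    by (rule funpow_vanish_mono[OF times_z_minus_w_add N1]) (simp add: N_def)
  have ac: "(times_z_minus_w ^^ N) (commutator_modes a c) = 0"
    by (rule funpow_vanish_mono[OF times_z_minus_w_add N2]) (simp add: N_def)
  let ?F1 = "\<lambda>k m n. Y a k (commutator_modes b c m n v)"
  let ?F2 = "\<lambda>k m n. commutator_modes a c k n (Y b m v)"
  have F: "(\<lambda>k m n. Y a k (Y b m (Y c n v)) - Y c n (Y a k (Y b m v))) = ?F1 + ?F2"
    by (simp add: fun_eq_iff Y_right)
  have 1: "(d23 ^^ N) ?F1 = 0"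
    using d23_pow_outer[of "Y a" N "commutator_modes b c" v, OF Y_right(2)] unfolding bc
    by (simp add: fun_eq_iff Y_right)
  have 2: "(d13 ^^ N) ?F2 = 0"
    unfolding d13_pow[of N "commutator_modes a c" "\<lambda>m. Y b m v"] ac by (simp add: fun_eq_iff)
  have "(d13 ^^ N) ((d23 ^^ N) (?F1 + ?F2)) = (d13 ^^ N) ((d23 ^^ N) ?F2)"
    unfolding funpow_additive(1)[of d23, OF d_additive(3)] 1 by simp
  also have "\<dots> = 0"
    unfolding funpow_commute[of d13 d23, OF d_commute(3)] 2 by (rule funpow_additive(2)[OF d_additive(3)])
  finally show ?thesis unfolding F local_in_third_def by blast
qed

text \<open>
  The coefficients of \<open>(z - w)\<^sup>-\<^sup>1 Y(a,z)Y(b,w)\<close>, where the inverse is expanded in nonnegative powers of \<open>w/z\<close>.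
  Applied to a vector, the sum is finite.
\<close>
definition divided_modes :: "'v \<Rightarrow> 'v \<Rightarrow> int \<Rightarrow> int \<Rightarrow> 'v \<Rightarrow> 'v" where
  "divided_modes a b k m v = (\<Sum>i | Y b (m + int i) v \<noteq> 0. Y a (k - 1 - int i) (Y b (m + int i) v))"

lemma divided_modes_finite_sum:
  assumes "\<And>i. i \<ge> L \<Longrightarrow> Y b (m + int i) v = 0"
  shows "divided_modes a b k m v = (\<Sum>i<L. Y a (k - 1 - int i) (Y b (m + int i) v))"
  unfolding divided_modes_def
proof (rule sum.mono_neutral_left)
  show "{i. Y b (m + int i) v \<noteq> 0} \<subseteq> {..<L}" using assms by (metis (mono_tags, lifting) lessThan_iff linorder_not_le mem_Collect_eq subsetI)
qed (auto simp: Y_right)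

lemma divided_modes_vanish: "(\<And>i. Y b (m + int i) v = 0) \<Longrightarrow> divided_modes a b k m v = 0"
  by (simp add: divided_modes_def)

lemma divided_modes_zero: "divided_modes a b k m 0 = 0"
  by (simp add: divided_modes_def Y_right)

lemma divided_modes_recursion: "divided_modes a b (k + 1) m v - divided_modes a b k (m + 1) v = Y a k (Y b m v)"
proof -
  obtain L where L: "\<And>j. j \<ge> L \<Longrightarrow> Y b j v = 0" using field_axiom by blast
  define l where "l = nat (L - m)"
  have 1: "divided_modes a b (k + 1) m v = (\<Sum>i<Suc l. Y a (k + 1 - 1 - int i) (Y b (m + int i) v))"
    by (rule divided_modes_finite_sum) (auto simp: l_def intro!: L)
  have 2: "divided_modes a b k (m + 1) v = (\<Sum>i<l. Y a (k - 1 - int i) (Y b (m + 1 + int i) v))"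
    by (rule divided_modes_finite_sum) (auto simp: l_def intro!: L)
  show ?thesis unfolding 1 2 sum.lessThan_Suc_shift by (simp add: algebra_simps)
qed

text \<open>
  Multiplication by \<open>z - w\<close> reduces the claim to the product \<open>Y(a,z)Y(b,w)\<close>, and it is injective on
  truncated distributions.
\<close>
lemma divided_modes_local:
  "local_in_third (\<lambda>k m n. divided_modes a b k m (Y c n v) - Y c n (divided_modes a b k m v))"
proof -
  let ?G = "\<lambda>k m n. divided_modes a b k m (Y c n v) - Y c n (divided_modes a b k m v)"
  let ?K = "\<lambda>k m n. Y a k (Y b m (Y c n v)) - Y c n (Y a k (Y b m v))"
  have GK: "d12 ?G = ?K"
  proof -
    have "?G (k + 1) m n - ?G k (m + 1) n = ?K k m n" for k m n
      unfolding divided_modes_recursion[of a b, symmetric] Y_right by simp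
    then show ?thesis unfolding d12_def by blast
  qed
  have tr: "truncated_second ?G" unfolding truncated_second_def
  proof
    fix n
    obtain L1 where L1: "\<And>j. j \<ge> L1 \<Longrightarrow> Y b j (Y c n v) = 0" using field_axiom by blast
    obtain L2 where L2: "\<And>j. j \<ge> L2 \<Longrightarrow> Y b j v = 0" using field_axiom by blast
    show "\<exists>L. \<forall>k. \<forall>m\<ge>L. ?G k m n = 0"
      by (rule exI[of _ "max L1 L2"]) (auto simp: L1 L2 divided_modes_vanish Y_right)
  qed
  obtain N where N: "(d13 ^^ N) ((d23 ^^ N) ?K) = 0"
    using commutators_local unfolding local_in_third_def by blast
  have tr': "truncated_second ((d13 ^^ i) ((d23 ^^ j) ?G))" for i j
  proof -
    have "truncated_second ((d23 ^^ j) ?G)" by (induction j) (simp_all add: tr truncated_second_d23)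
    then show ?thesis by (induction i) (simp_all add: truncated_second_d13)
  qed
  have "d12 ((d13 ^^ N) ((d23 ^^ N) ?G)) = (d13 ^^ N) ((d23 ^^ N) (d12 ?G))"
    by (simp only: d12_pow_commute)
  then have "d12 ((d13 ^^ N) ((d23 ^^ N) ?G)) = 0" unfolding GK N .
  then have "(d13 ^^ N) ((d23 ^^ N) ?G) = 0" by (rule truncated_second_zero[OF tr'])
  then show ?thesis unfolding local_in_third_def by blast
qed

text \<open>
  Both sides are truncated in \<open>w\<close>, and multiplication by \<open>z - w\<close> turns the claim into the translation
  covariance of \<open>Y(a,z)Y(b,w)\<close>.
\<close>
lemma divided_modes_translation:
  "T (divided_modes a b k m v) - divided_modes a b k m (T v)
    = scale (of_int (- k)) (divided_modes a b (k - 1) m v) + scale (of_int (- m)) (divided_modes a b k (m - 1) v)"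
proof -
  define R where "R k m = T (divided_modes a b k m v) - divided_modes a b k m (T v) + scale (of_int k) (divided_modes a b (k - 1) m v)
    + scale (of_int m) (divided_modes a b k (m - 1) v)" for k m
  obtain L1 where L1: "\<And>j. j \<ge> L1 \<Longrightarrow> Y b j (T v) = 0" using field_axiom by blast
  obtain L2 where L2: "\<And>j. j \<ge> L2 \<Longrightarrow> Y b j v = 0" using field_axiom by blast
  have "R k m = 0" for k m
  proof (rule antidiagonal_vanish[of R "max L1 L2 + 1"])
    fix k m :: int assume "m \<ge> max L1 L2 + 1"
    then show "R k m = 0" unfolding R_def by (simp add: divided_modes_vanish L1 L2 T_simps)
  next
    fix k m :: int
    have e1: "T (divided_modes a b (k + 1) m v) = T (divided_modes a b k (m + 1) v) + T (Y a k (Y b m v))"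
      using divided_modes_recursion[of a b k m v] by (metis T_simps(1) add.commute diff_add_cancel)
    have e2: "divided_modes a b (k + 1) m (T v) = divided_modes a b k (m + 1) (T v) + Y a k (Y b m (T v))"
      using divided_modes_recursion[of a b k m "T v"] by (metis add.commute diff_add_cancel)
    have e3: "divided_modes a b k m v = divided_modes a b (k - 1) (m + 1) v + Y a (k - 1) (Y b m v)"
      using divided_modes_recursion[of a b "k - 1" m v] by (simp add: algebra_simps)
    have e4: "divided_modes a b (k + 1) (m - 1) v = divided_modes a b k m v + Y a k (Y b (m - 1) v)"
      using divided_modes_recursion[of a b k "m - 1" v] by (simp add: algebra_simps)
    have e5: "T (Y a k (Y b m v)) = Y a k (Y b m (T v)) + scale (of_int (- m)) (Y a k (Y b (m - 1) v))
      + scale (of_int (- k)) (Y a (k - 1) (Y b m v))"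
      using translation_product[of a k b m v] by (simp only: diff_eq_eq ac_simps)
    show "R (k + 1) m = R k (m + 1)"
      unfolding R_def e1 e2 e4 e5
      by (simp add: e3 algebra_simps)
  qed
  then show ?thesis unfolding R_def by (simp add: algebra_simps eq_neg_iff_add_eq_0)
qed

text \<open>
  The two summands are the parts of the usual formula
  \<open>(ab)\<^bsub>(m)\<^esub> = \<Sum>\<^sub>i a\<^bsub>(-1-i)\<^esub> b\<^bsub>(m+i)\<^esub> + b\<^bsub>(m-1-i)\<^esub> a\<^bsub>(i)\<^esub>\<close>, where \<open>i \<ge> 0\<close>. They are the residue in \<open>z\<close> of a distribution
  which becomes the commutator of \<open>Y(a,z)\<close> and \<open>Y(b,w)\<close> when it is multiplied by \<open>z - w\<close>; so it is killed
  by a power of \<open>z - w\<close>, as the uniqueness of fields requires.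
\<close>
lemma normally_ordered_modes:
  "Y (Y a (- 1) b) m v = divided_modes a b 0 m v + divided_modes b a m 0 v"
proof -
  let ?Q = "\<lambda>k m v. divided_modes a b k m v + divided_modes b a m k v"
  have X: "times_z_minus_w ?Q = commutator_modes a b"
    unfolding times_z_minus_w_def divided_modes_recursion[symmetric] by (simp add: fun_eq_iff algebra_simps)
  obtain N where N: "(times_z_minus_w ^^ N) (commutator_modes a b) = 0" by (rule locality_exponent)
  have "?Q 0 m v = Y (Y a (- 1) b) m v"
  proof (rule field_uniqueness[where M = "Suc N"])
    show "(times_z_minus_w ^^ Suc N) ?Q = 0" using N X by (simp add: funpow_swap1)
  next
    fix c
    let ?G1 = "\<lambda>k m n. divided_modes a b k m (Y c n vac) - Y c n (divided_modes a b k m vac)"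
    let ?G2 = "\<lambda>k m n. divided_modes b a k m (Y c n vac) - Y c n (divided_modes b a k m vac)"
    have "(\<lambda>k m n. ?Q k m (Y c n vac) - Y c n (?Q k m vac)) = ?G1 + (\<lambda>k m n. ?G2 m k n)"
      by (simp add: fun_eq_iff Y_right)
    moreover have "local_in_third (?G1 + (\<lambda>k m n. ?G2 m k n))"
      by (intro local_in_third_add local_in_third_swap[of ?G2] divided_modes_local)
    ultimately show "\<exists>N. (d13 ^^ N) ((d23 ^^ N) (\<lambda>k m n. ?Q k m (Y c n vac) - Y c n (?Q k m vac))) = 0"
      unfolding local_in_third_def by simp
  next
    fix m
    show "T (?Q 0 m vac) = scale (of_int (- m)) (?Q 0 (m - 1) vac)"
      using divided_modes_translation[of a b 0 m vac] divided_modes_translation[of b a m 0 vac]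
      by (simp add: T_vac divided_modes_zero T_simps scale_right_distrib)
  next
    fix m :: int assume "m \<ge> 0"
    then show "?Q 0 m vac = 0" by (simp add: divided_modes_vanish vacuum_regular)
  next
    have "divided_modes a b 0 (- 1) vac = Y a (- 1) b"
      by (subst divided_modes_finite_sum[of 1]) (auto simp: vacuum_regular vacuum_creation)
    then show "?Q 0 (- 1) vac = Y a (- 1) b" by (simp add: divided_modes_vanish vacuum_regular)
  qed (simp add: divided_modes_zero)
  then show ?thesis by simp
qed

definition nth_product_modes :: "nat \<Rightarrow> 'v \<Rightarrow> 'v \<Rightarrow> int \<Rightarrow> int \<Rightarrow> 'v \<Rightarrow> 'v" where
  "nth_product_modes n a b = (times_z_minus_w ^^ n) (commutator_modes a b)"

lemma nth_product_modes_Suc: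
  "nth_product_modes (Suc n) a b k m v = nth_product_modes n a b (k + 1) m v - nth_product_modes n a b k (m + 1) v"
  by (simp add: nth_product_modes_def times_z_minus_w_def)

lemma nth_product_modes_translation:
  "T (nth_product_modes n a b k m v) - nth_product_modes n a b k m (T v)
    = scale (of_int (- k)) (nth_product_modes n a b (k - 1) m v) + scale (of_int (- m)) (nth_product_modes n a b k (m - 1) v)"
proof (induction n arbitrary: k m)
  case 0
  have "T (Y a k (Y b m v)) = Y a k (Y b m (T v)) + (scale (of_int (- m)) (Y a k (Y b (m - 1) v))
      + scale (of_int (- k)) (Y a (k - 1) (Y b m v)))"
    "T (Y b m (Y a k v)) = Y b m (Y a k (T v)) + (scale (of_int (- k)) (Y b m (Y a (k - 1) v))
      + scale (of_int (- m)) (Y b (m - 1) (Y a k v)))"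
    using translation_product[of a k b m v] translation_product[of b m a k v]
    by (simp_all only: diff_eq_eq ac_simps)
  note e = this
  show ?case
    unfolding nth_product_modes_def funpow_0 T_simps e by (simp add: algebra_simps)
next
  case (Suc n)
  have "T (nth_product_modes n a b (k + 1) m v) = nth_product_modes n a b (k + 1) m (T v)
      + (scale (of_int (- (k + 1))) (nth_product_modes n a b k m v)
        + scale (of_int (- m)) (nth_product_modes n a b (k + 1) (m - 1) v))"
    "T (nth_product_modes n a b k (m + 1) v) = nth_product_modes n a b k (m + 1) (T v)
      + (scale (of_int (- k)) (nth_product_modes n a b (k - 1) (m + 1) v)
        + scale (of_int (- (m + 1))) (nth_product_modes n a b k m v))"
    using Suc[of "k + 1" m] Suc[of k "m + 1"] by (simp_all only: diff_eq_eq ac_simps add_diff_cancel_left' add_diff_cancel_right')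
  note e = this
  show ?case
    unfolding nth_product_modes_Suc T_simps e by (simp add: algebra_simps)
qed

lemma nth_product:
  "Y (Y a (int n) b) m v = nth_product_modes n a b 0 m v"
proof -
  let ?Q = "nth_product_modes n a b"
  obtain N where N: "(times_z_minus_w ^^ N) (commutator_modes a b) = 0" by (rule locality_exponent)
  have "?Q 0 m v = Y (Y a (int n) b) m v"
  proof (rule field_uniqueness[where M = N])
    show "(times_z_minus_w ^^ N) ?Q = 0"
      unfolding nth_product_modes_def funpow_commute[of times_z_minus_w times_z_minus_w N n, OF refl] N
      by (rule funpow_additive(2)[OF times_z_minus_w_add])
  next
    fix c
    let ?K1 = "\<lambda>k m n. Y a k (Y b m (Y c n vac)) - Y c n (Y a k (Y b m vac))"
    let ?K2 = "\<lambda>k m n. Y b k (Y a m (Y c n vac)) - Y c n (Y b k (Y a m vac))"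
    have "local_in_third ((d12 ^^ n) (?K1 - (\<lambda>k m n. ?K2 m k n)))"
      by (intro local_in_third_d12 local_in_third_add local_in_third_swap[of ?K2] commutators_local)
    moreover have "?K1 - (\<lambda>k m n. ?K2 m k n)
      = (\<lambda>k m n. commutator_modes a b k m (Y c n vac)) - (\<lambda>k m n. Y c n (commutator_modes a b k m vac))"
      by (simp add: fun_eq_iff Y_right)
    moreover have "(d12 ^^ n) \<dots> = (\<lambda>k m n. ?Q k m (Y c n vac) - Y c n (?Q k m vac))"
      unfolding funpow_additive(3)[of d12, OF d_additive(1)]
        d12_pow[of _ "commutator_modes a b" "\<lambda>n. Y c n vac"]
        d12_pow_outer[of "\<lambda>n. Y c n" n "commutator_modes a b" vac, OF Y_right(2)] nth_product_modes_def
      by (simp only: fun_eq_iff minus_apply) simp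
    ultimately show "\<exists>N. (d13 ^^ N) ((d23 ^^ N) (\<lambda>k m n. ?Q k m (Y c n vac) - Y c n (?Q k m vac))) = 0"
      unfolding local_in_third_def by simp
  next
    fix m
    show "T (?Q 0 m vac) = scale (of_int (- m)) (?Q 0 (m - 1) vac)"
    proof -
      have "nth_product_modes n a b 0 m 0 = 0"
        by (simp add: nth_product_modes_def times_z_minus_w_pow Y_right)
      then show ?thesis using nth_product_modes_translation[of n a b 0 m vac] by (simp add: T_vac)
    qed
  next
    fix m :: int assume "m \<ge> 0"
    then show "?Q 0 m vac = 0" by (simp add: nth_product_modes_def times_z_minus_w_pow vacuum_regular Y_right)
  next
    show "?Q 0 (- 1) vac = Y a (int n) b"
    proof -
      have "?Q 0 (- 1) vac = (\<Sum>j\<in>{0}. scale ((-1) ^ j * of_nat (n choose j)) (Y a (int n - int j) (Y b (int j - 1) vac)))"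
        unfolding nth_product_modes_def times_z_minus_w_pow
        by (rule sum.mono_neutral_cong_right) (auto simp: vacuum_regular Y_right)
      then show ?thesis by (simp add: vacuum_creation)
    qed
  qed (simp add: nth_product_modes_def times_z_minus_w_pow Y_right)
  then show ?thesis by simp
qed

text \<open>
  The commutator formula \<open>[a\<^bsub>(k)\<^esub>, b\<^bsub>(l)\<^esub>] = \<Sum>\<^sub>j (k choose j) (a\<^bsub>(j)\<^esub> b)\<^bsub>(k+l-j)\<^esub>\<close> without its coefficients. The recursion
  \<open>nth_product_modes_Suc\<close> leads from the index \<open>k = 0\<close>, where the modes are those of \<open>a\<^bsub>(j)\<^esub> b\<close>, to all others. For
  negative \<open>k\<close> it has to start from a \<open>j\<close> at which locality makes everything vanish.
\<close>
lemma commutator_mem: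
  assumes U: "subspace U" and mem: "\<And>j l. Y (Y a (int j) b) l w \<in> U"
  shows "Y a k (Y b l w) - Y b l (Y a k w) \<in> U"
proof -
  let ?D = "\<lambda>j k l. nth_product_modes j a b k l w"
  have D0: "?D j 0 l \<in> U" for j l using mem by (simp add: nth_product)
  have pos: "?D j (int i) l \<in> U" for i j l
  proof (induction i arbitrary: j l)
    case (Suc i)
    have "?D j (int i + 1) l = ?D (Suc j) (int i) l + ?D j (int i) (l + 1)"
      by (simp add: nth_product_modes_Suc)
    then show ?case using Suc subspace_add[OF U] by (simp add: add.commute)
  qed (simp add: D0)
  obtain N where "(times_z_minus_w ^^ N) (commutator_modes a b) = 0" by (rule locality_exponent)
  then have N: "?D j k l = 0" if "j \<ge> N" for j k l
    using funpow_vanish_mono[OF times_z_minus_w_add _ that, of "commutator_modes a b"]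
    by (simp add: nth_product_modes_def)
  have neg: "?D j (- int i) l \<in> U" for i j l
  proof (induction i arbitrary: j l)
    case (Suc i)
    have "?D (N - t) (- int (Suc i)) l \<in> U" for t l
    proof (induction t arbitrary: l)
      case 0
      then show ?case using N U by (simp add: subspace_0)
    next
      case (Suc t)
      show ?case
      proof (cases "t < N")
        case True
        then have "?D (N - Suc t) (- int (Suc i)) l
          = ?D (N - Suc t) (- int i) (l - 1) - ?D (N - t) (- int (Suc i)) (l - 1)"
          using nth_product_modes_Suc[of "N - Suc t" a b "- int (Suc i)" "l - 1" w]
          by (simp add: Suc_diff_Suc)
        then show ?thesis using Suc \<open>\<And>j l. ?D j (- int i) l \<in> U\<close> subspace_diff[OF U] by simp
      qed (use Suc in simp)
    qed
    from this[of "N - j" l] show ?case using N[of j] U by (cases "j \<le> N") (simp_all add: subspace_0)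
  qed (simp add: D0)
  have "?D 0 k l \<in> U" using pos[of 0 "nat k" l] neg[of 0 "nat (- k)" l] by (cases "k \<ge> 0") simp_all
  then show ?thesis by (simp add: nth_product_modes_def)
qed

section \<open>Ideals generated by a set\<close>

text \<open>
  Weak skew-symmetry expresses \<open>w\<^bsub>(n)\<^esub> b\<close> through modes of \<open>b\<close> applied to the vectors \<open>w\<^bsub>(m)\<^esub> vac\<close>, which
  are multiples of derivatives of \<open>w\<close>.
\<close>
lemma left_submodule_is_ideal:
  assumes "subspace W" and TW: "\<And>w. w \<in> W \<Longrightarrow> T w \<in> W"
    and left: "\<And>b m w. w \<in> W \<Longrightarrow> Y b m w \<in> W"
  shows "va_ideal W"
  unfolding va_ideal_def
proof (intro conjI ballI allI)
  fix w b n assume w: "w \<in> W"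
  have vacuum: "Y w m vac \<in> W" for m
  proof (cases "m \<ge> 0")
    case False
    have "Y w (- 1 - int i) vac \<in> W" for i
    proof (induction i)
      case (Suc i)
      let ?c = "of_int (- (- 1 - int i)) :: complex"
      have "scale ?c (Y w (- 1 - int i - 1) vac) \<in> W"
        using translation_commutator[of w "- 1 - int i" vac] TW[OF Suc]
        by (simp only: T_vac Y_right diff_zero)
      then have "scale (inverse ?c) (scale ?c (Y w (- 1 - int i - 1) vac)) \<in> W"
        by (rule subspace_scale[OF assms(1)])
      moreover have "?c \<noteq> 0" by (simp only: of_int_eq_0_iff)
      ultimately have "Y w (- 1 - int i - 1) vac \<in> W" by simp
      then show ?case by (simp add: algebra_simps)
    qed (simp add: vacuum_creation w)
    from this[of "nat (- 1 - m)"] False show ?thesis by simp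
  qed (simp add: vacuum_regular subspace_0[OF assms(1)])
  obtain N where "\<And>m. Y w m b =
    (\<Sum>j\<le>N. scale ((-1) ^ j * of_nat (N choose j)) (Y b (int j - 1) (Y w (m - int j) vac)))"
    by (rule skew_symmetry_weak[of w b]) blast
  then show "Y w n b \<in> W"
    using left[OF vacuum] by (simp only:) (intro subspace_sum subspace_scale assms(1))
qed (use assms in auto)

text \<open>
  The point is that \<open>b\<^bsub>(m)\<^esub> (a\<^bsub>(p)\<^esub> c)\<close> stays in the span. The commutator formula would only lead to
  \<open>(b\<^bsub>(j)\<^esub> a)\<^bsub>(n)\<^esub> c\<close>, where \<open>b\<^bsub>(j)\<^esub> a\<close> may leave \<open>A\<close>. Instead, modulo the span, locality of \<open>a\<close> and \<open>b\<close> is a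
  linear recursion for these vectors along \<open>m + p\<close> constant, which descends from large \<open>p\<close>, where they
  vanish.
\<close>
lemma products_span_ideal: "va_ideal (span {Y a n c | a n c. a \<in> A})" (is "va_ideal ?W")
proof (rule left_submodule_is_ideal)
  have prod: "Y a n c \<in> ?W" if "a \<in> A" for a n c using that by (intro span_base) blast
  show "T w \<in> ?W" if "w \<in> ?W" for w using that
  proof (induction rule: span_induct_alt)
    case base
    then show ?case by (simp add: T_simps span_zero)
  next
    case (step r x y)
    then obtain a n c where x: "x = Y a n c" "a \<in> A" by blast
    have "T x = Y a n (T c) + scale (of_int (- n)) (Y a (n - 1) c)"
      using translation_commutator[of a n c] unfolding x by (simp only: diff_eq_eq add.commute)
    then have "T x \<in> ?W" using x(2) by (simp only:) (intro span_add span_scale prod)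
    with step show ?case by (simp add: T_simps span_add span_scale)
  qed
  have left: "Y b m (Y a p c) \<in> ?W" if a: "a \<in> A" for a b c m p
  proof -
    obtain N where N: "(times_z_minus_w ^^ N) (commutator_modes a b) = 0" by (rule locality_exponent)
    obtain L where L: "\<And>j. j \<ge> L \<Longrightarrow> Y a j c = 0" using field_axiom by blast
    have "Y b m (Y a (L - int t) c) \<in> ?W" for t m
    proof (induction t arbitrary: m rule: less_induct)
      case (less t)
      let ?c = "\<lambda>j. (-1) ^ j * of_nat (N choose j) :: complex"
      let ?p = "L - int t" and ?q = "m - int N"
      let ?term = "\<lambda>j. scale (?c j) (Y b (?q + int j) (Y a (?p + int N - int j) c))"
      have later: "?term j \<in> ?W" if "j < N" for j
      proof (cases "t < N - j")
        case True
        then have "Y a (?p + int N - int j) c = 0" by (intro L) simp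
        then show ?thesis by (simp add: Y_right span_zero)
      next
        case False
        then show ?thesis using less[of "t - (N - j)" "?q + int j"] that
          by (auto intro!: span_scale simp: of_nat_diff algebra_simps)
      qed
      (* locality at the indices for which the summand j = N is the vector in question up to sign *)
      have "(\<Sum>j\<le>N. scale (?c j) (Y a (?p + int N - int j) (Y b (?q + int j) c))) - (\<Sum>j\<le>N. ?term j) = 0"
        using times_z_minus_w_pow[of N "commutator_modes a b" ?p ?q c] N
        by (simp add: sum_subtractf[symmetric] scale_right_diff_distrib)
      then have "(\<Sum>j\<le>N. ?term j) = (\<Sum>j\<le>N. scale (?c j) (Y a (?p + int N - int j) (Y b (?q + int j) c)))"
        by simp
      also have "\<dots> \<in> ?W" by (intro span_sum span_scale prod a)
      finally have "(\<Sum>j<N. ?term j) + ?term N \<in> ?W"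
        by (simp add: lessThan_Suc_atMost[symmetric])
      moreover have "(\<Sum>j<N. ?term j) \<in> ?W" by (intro span_sum later) simp
      ultimately have "?term N \<in> ?W" using span_add_eq by blast
      then have "scale ((-1) ^ N) (?term N) \<in> ?W" by (rule span_scale)
      then show ?case by (simp add: power_mult_distrib[symmetric] power_add[symmetric])
    qed
    from this[of m "nat (L - p)"] L[of p] show ?thesis
      by (cases "p \<ge> L") (simp_all add: Y_right span_zero)
  qed
  show "Y b m w \<in> ?W" if "w \<in> ?W" for b m w using that
  proof (induction rule: span_induct_alt)
    case base
    then show ?case by (simp add: Y_right span_zero)
  next
    case (step r x y)
    then have "Y b m x \<in> ?W" using left by blast
    with step show ?case by (simp add: Y_right span_add span_scale)
  qed
qed (rule subspace_span)

text \<open>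
  The vector \<open>a\<^bsub>(-1-n)\<^esub> vac\<close> is the divided power \<open>T\<^sup>n a / n!\<close>. For \<open>0 \<le> j < n\<close> the coefficient vanishes, so that
  nonnegative modes of a divided power are multiples of nonnegative modes of \<open>a\<close>.
\<close>
lemma Y_divided_power:
  "Y (Y a (- 1 - int n) vac) j b = scale ((-1) ^ n * (of_int j gchoose n)) (Y a (j - int n) b)"
proof (induction n arbitrary: j)
  case 0
  then show ?case by (simp add: vacuum_creation)
next
  case (Suc n)
  have "T (Y a (- 1 - int n) vac) = scale (of_nat (Suc n)) (Y a (- 1 - int (Suc n)) vac)"
    using translation_commutator[of a "- 1 - int n" vac] by (simp add: T_vac Y_right algebra_simps)
  then have "scale (of_nat (Suc n)) (Y (Y a (- 1 - int (Suc n)) vac) j b)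
    = scale (of_int (- j)) (Y (Y a (- 1 - int n) vac) (j - 1) b)"
    using translation_derivative[of "Y a (- 1 - int n) vac" j b] by (simp only: Y_left)
  also have "\<dots> = scale (of_nat (Suc n)) (scale ((-1) ^ Suc n * (of_int j gchoose Suc n)) (Y a (j - int (Suc n)) b))"
  proof -
    have "of_nat (Suc n) * (of_int j gchoose Suc n) = of_int j * (of_int (j - 1) gchoose n :: complex)"
      using gbinomial_absorption[of n "of_int j :: complex"] by simp
    then have "of_int (- j) * ((-1) ^ n * (of_int (j - 1) gchoose n))
        = (of_nat (Suc n) * ((-1) ^ Suc n * (of_int j gchoose Suc n)) :: complex)"
      by (simp only: power_Suc of_int_minus mult.assoc mult.left_commute[of "of_nat (Suc n)"]) simp
    moreover have "j - 1 - int n = j - int (Suc n)" by simp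
    ultimately show ?thesis by (simp only: Suc scale_scale)
  qed
  finally show ?case by (metis scale_cancel_left of_nat_eq_0_iff nat.distinct(1))
qed

lemma T_pow_vacuum: "(T ^^ i) a = scale (fact i) (Y a (- 1 - int i) vac)"
proof (induction i)
  case (Suc i)
  have "T (Y a (- 1 - int i) vac) = scale (of_nat (Suc i)) (Y a (- 1 - int (Suc i)) vac)"
    using translation_commutator[of a "- 1 - int i" vac] by (simp add: T_vac Y_right algebra_simps)
  then show ?case by (simp add: Suc T_simps mult.commute)
qed (simp add: vacuum_creation)

end

section \<open>Homogeneous components and conformal weights\<close>

context graded_vector_space
begin

definition component :: "nat \<Rightarrow> 'v \<Rightarrow> 'v" where
  "component n v = (THE f. (\<forall>n. f n \<in> gr n) \<and> finite {n. f n \<noteq> 0} \<and> v = (\<Sum>n | f n \<noteq> 0. f n)) n"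

lemma component_unique:
  assumes "\<And>n. f n \<in> gr n" "finite A" "\<And>n. n \<notin> A \<Longrightarrow> f n = 0" "v = (\<Sum>n\<in>A. f n)"
  shows "component n v = f n"
proof -
  have "{n. f n \<noteq> 0} \<subseteq> A" using assms(3) by auto
  then have "finite {n. f n \<noteq> 0}" "v = (\<Sum>n | f n \<noteq> 0. f n)"
    using assms(2,4) finite_subset by (auto intro!: sum.mono_neutral_right)
  then have "(THE f. (\<forall>n. f n \<in> gr n) \<and> finite {n. f n \<noteq> 0} \<and> v = (\<Sum>n | f n \<noteq> 0. f n)) = f"
    using assms(1) direct_sum[of v] by (intro the1_equality) blast+
  then show ?thesis by (simp add: component_def)
qed

lemma component_decomposition:
  obtains A where "finite A" "\<And>n. n \<notin> A \<Longrightarrow> component n v = 0" "v = (\<Sum>n\<in>A. component n v)"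
    "\<And>n. component n v \<in> gr n"
proof -
  obtain f where f: "\<And>n. f n \<in> gr n" "finite {n. f n \<noteq> 0}" "v = (\<Sum>n | f n \<noteq> 0. f n)"
    using direct_sum[of v] by blast
  then have "component n v = f n" for n by (intro component_unique) auto
  then show ?thesis using that[of "{n. f n \<noteq> 0}"] f by simp
qed

lemma component_gr: "component n v \<in> gr n"
  using component_decomposition[of v] by blast

lemma component_add: "component n (v + w) = component n v + component n w"
proof -
  obtain A where A: "finite A" "\<And>n. n \<notin> A \<Longrightarrow> component n v = 0" "v = (\<Sum>n\<in>A. component n v)"
    using component_decomposition[of v] by metis
  obtain B where B: "finite B" "\<And>n. n \<notin> B \<Longrightarrow> component n w = 0" "w = (\<Sum>n\<in>B. component n w)"
    using component_decomposition[of w] by metis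
  have "(\<Sum>n\<in>A \<union> B. component n v) = v" "(\<Sum>n\<in>A \<union> B. component n w) = w"
    using A B by (metis (no_types, lifting) finite_UnI sum.mono_neutral_right sup_ge1 sup_ge2 DiffE)+
  then show ?thesis using A(1,2) B(1,2)
    by (intro component_unique[of "\<lambda>n. component n v + component n w" "A \<union> B"])
      (auto simp: sum.distrib intro: subspace_add subspace_gr component_gr)
qed

lemma component_scale: "component n (scale c v) = scale c (component n v)"
proof -
  obtain A where A: "finite A" "\<And>n. n \<notin> A \<Longrightarrow> component n v = 0" "v = (\<Sum>n\<in>A. component n v)"
    using component_decomposition[of v] by metis
  show ?thesis
  proof (rule component_unique[of "\<lambda>n. scale c (component n v)" A])
    show "scale c v = (\<Sum>n\<in>A. scale c (component n v))"
      by (subst A(3)) (simp add: scale_sum_right)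
  qed (use A(1,2) in \<open>auto intro: subspace_scale subspace_gr component_gr\<close>)
qed

lemma component_zero: "component n 0 = 0"
  using component_scale[of n 0 0] by simp

lemma component_sum: "component n (sum f A) = (\<Sum>x\<in>A. component n (f x))"
  by (induction A rule: infinite_finite_induct) (simp_all add: component_zero component_add)

lemma component_homogeneous: "v \<in> gr m \<Longrightarrow> component n v = (if n = m then v else 0)"
  using component_unique[of "\<lambda>n. if n = m then v else 0" "{m}" v n]
  by (auto simp: subspace_0 subspace_gr)

lemma component_mem:
  assumes "homogeneous_subspace U" "v \<in> U" shows "component n v \<in> U"
proof -
  have U: "subspace U" "U = span (\<Union>n. U \<inter> gr n)" using assms(1) by (auto simp: homogeneous_subspace_def)
  have "v \<in> span (\<Union>n. U \<inter> gr n)" using assms(2) U(2) by simp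
  then show ?thesis
  proof (induction rule: span_induct_alt)
    case base
    then show ?case by (simp add: component_zero subspace_0 U(1))
  next
    case (step c x y)
    then have "component n x \<in> U" by (auto simp: component_homogeneous subspace_0 U(1))
    with step show ?case by (simp add: component_add component_scale subspace_add subspace_scale U(1))
  qed
qed

text \<open>
  The product \<open>a\<^bsub>(k)\<^esub> b\<close> of homogeneous vectors has a weight that can be negative; it is zero then.
\<close>
definition gr_int :: "int \<Rightarrow> 'v set" where "gr_int k = (if k < 0 then {0} else gr (nat k))"

end

context vertex_operator_algebra
begin

lemma conformal_vector:
  obtains \<omega> where "\<And>n a. a \<in> gr n \<Longrightarrow> Y \<omega> 0 a = T a" "\<And>n a. a \<in> gr n \<Longrightarrow> Y \<omega> 1 a = scale (of_nat n) a"
proof -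
  obtain \<omega> where \<omega>: "\<And>n a. a \<in> gr n \<Longrightarrow> \<exists>r. lambda_bracket \<omega> a = [:T a, scale (of_nat n) a:] + pCons 0 (pCons 0 r)"
    using virasoro_element by blast
  have "Y \<omega> 0 a = T a \<and> Y \<omega> 1 a = scale (of_nat n) a" if a: "a \<in> gr n" for n a
  proof -
    obtain r where r: "lambda_bracket \<omega> a = [:T a, scale (of_nat n) a:] + pCons 0 (pCons 0 r)"
      using \<omega>[OF a] by blast
    show ?thesis
      using arg_cong[OF r, of "\<lambda>p. coeff p 0"] arg_cong[OF r, of "\<lambda>p. coeff p 1"]
      unfolding coeff_lambda_bracket by simp
  qed
  then show ?thesis using that by blast
qed

text \<open>
  By the commutator formula for \<open>\<omega>\<^bsub>(1)\<^esub>\<close>, the vector \<open>a\<^bsub>(k)\<^esub> b\<close> is an eigenvector of \<open>\<omega>\<^bsub>(1)\<^esub>\<close> with eigenvalue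
  \<open>m + n - k - 1\<close>, and \<open>\<omega>\<^bsub>(1)\<^esub>\<close> acts as \<open>n\<close> on \<open>gr n\<close>.
\<close>
lemma Y_gr_int:
  assumes a: "a \<in> gr m" and b: "b \<in> gr n"
  shows "Y a k b \<in> gr_int (int m + int n - k - 1)"
proof -
  obtain \<omega> where \<omega>0: "\<And>n a. a \<in> gr n \<Longrightarrow> Y \<omega> 0 a = T a"
    and \<omega>1: "\<And>n a. a \<in> gr n \<Longrightarrow> Y \<omega> 1 a = scale (of_nat n) a"
    by (rule conformal_vector) blast
  let ?x = "Y a k b" and ?k = "int m + int n - k - 1"
  have "nth_product_modes 0 \<omega> a (0 + 1) k b = nth_product_modes 1 \<omega> a 0 k b + nth_product_modes 0 \<omega> a 0 (k + 1) b"
    using nth_product_modes_Suc[of 0 \<omega> a 0 k b] by simp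
  then have "Y \<omega> 1 ?x - Y a k (Y \<omega> 1 b) = Y (Y \<omega> 1 a) k b + Y (Y \<omega> 0 a) (k + 1) b"
    using nth_product[of \<omega> 0 a "k + 1" b] nth_product[of \<omega> 1 a k b]
    by (simp add: nth_product_modes_def[of 0])
  then have "Y \<omega> 1 ?x = scale (of_int (int m) + of_int (int n) - of_int k - 1) ?x"
    by (simp add: \<omega>1[OF a] \<omega>1[OF b] \<omega>0[OF a] Y_left Y_right translation_derivative algebra_simps)
  then have eig: "Y \<omega> 1 ?x = scale (of_int ?k) ?x" by simp
  obtain A where A: "finite A" "\<And>n. n \<notin> A \<Longrightarrow> component n ?x = 0" "?x = (\<Sum>n\<in>A. component n ?x)"
    using component_decomposition[of ?x] by metis
  have "Y \<omega> 1 ?x = (\<Sum>n\<in>A. scale (of_nat n) (component n ?x))"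
    by (subst A(3)) (simp add: Y_right \<omega>1[OF component_gr])
  then have "component i (Y \<omega> 1 ?x) = scale (of_nat i) (component i ?x)" for i
    using A by (intro component_unique[of "\<lambda>i. scale (of_nat i) (component i ?x)" A])
      (auto intro: subspace_scale subspace_gr component_gr)
  then have "scale (of_int (int i - ?k)) (component i ?x) = 0" for i
    unfolding eig component_scale by (simp only: of_int_diff scale_left_diff_distrib) simp
  then have z: "component i ?x = 0" if "int i \<noteq> ?k" for i
    using that by (metis of_int_eq_0_iff right_minus_eq scale_eq_0_iff)
  show ?thesis
  proof (cases "?k < 0")
    case True
    then have "component i ?x = 0" for i by (intro z) simp
    then show ?thesis using A(3) True by (simp add: gr_int_def)
  next
    case False
    have "?x = (\<Sum>i\<in>A. if i = nat ?k then component i ?x else 0)"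
      by (subst A(3), rule sum.cong) (use z False in auto)
    also have "\<dots> \<in> gr (nat ?k)"
      by (intro subspace_sum subspace_gr) (auto simp: component_gr subspace_0 subspace_gr)
    finally show ?thesis using False by (simp add: gr_int_def)
  qed
qed

section \<open>High derivatives lie in every nonzero right ideal\<close>

lemma right_ideal_subspace: "right_ideal J \<Longrightarrow> subspace J"
  by (simp add: right_ideal_def homogeneous_subspace_def)

lemma right_ideal_negative_mode:
  assumes J: "right_ideal J" and "a \<in> J" shows "Y a (- 1 - int i) b \<in> J"
  using assms(2)
proof (induction i arbitrary: a)
  case 0
  then show ?case using J by (simp add: right_ideal_def normally_ordered_def)
next
  case (Suc i)
  have "Y (T a) (- 1 - int i) b \<in> J" using Suc J by (simp add: right_ideal_def)
  then have "scale (inverse (of_nat (Suc i))) (Y (T a) (- 1 - int i) b) \<in> J"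
    by (rule subspace_scale[OF right_ideal_subspace[OF J]])
  moreover have "Y (T a) (- 1 - int i) b = scale (of_nat (Suc i)) (Y a (- 1 - int (Suc i)) b)"
    using translation_derivative[of a "- 1 - int i" b] by (simp add: algebra_simps)
  ultimately show ?case by (simp del: of_nat_Suc)
qed

text \<open>
  For \<open>a' = T\<^sup>n a / n! \<in> J\<close> the vector \<open>(a'b)\<^bsub>(-1-s)\<^esub> c\<close> lies in \<open>J\<close>, and so do the terms
  \<open>a'\<^bsub>(-1-i)\<^esub> (b\<^bsub>(i-1-s)\<^esub> c)\<close> of its expansion. The other terms combine the vectors \<open>b\<^bsub>(-2-M-i)\<^esub> (a\<^bsub>(i)\<^esub> c)\<close>, where
  \<open>M = s + n\<close>. For fixed \<open>M\<close> one can take \<open>n = 0, \<dots>, M\<close>, and the coefficients form a binomial system; it can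
  be solved for each of them as soon as \<open>M \<ge> L\<close>, where \<open>a\<^bsub>(i)\<^esub> c = 0\<close> for all \<open>i \<ge> L\<close>.
\<close>
lemma deep_modes_mem:
  assumes J: "right_ideal J" and a: "a \<in> J"
  shows "\<exists>K. \<forall>M\<ge>K. \<forall>b. Y b (- 1 - int M) (Y a (int i) c) \<in> J"
proof -
  note sJ = right_ideal_subspace[OF J]
  obtain L0 where L0: "\<And>j. j \<ge> L0 \<Longrightarrow> Y a j c = 0" using field_axiom by blast
  define L where "L = nat L0"
  have L: "Y a (int j) c = 0" if "j \<ge> L" for j using that by (intro L0) (simp add: L_def)
  have "Y b (- 2 - int M - int i) (Y a (int i) c) \<in> J" if M: "L \<le> M" and i: "i < L" for M b
  proof (rule binomial_system_mem[OF sJ, of 0 L "\<lambda>i. Y b (- 2 - int M - int i) (Y a (int i) c)", OF _ i])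
    fix n assume "n < 0 + L"
    define s where "s = M - n"
    have s: "M = s + n" using M \<open>n < 0 + L\<close> by (simp add: s_def)
    let ?a = "Y a (- 1 - int n) vac"
    have aJ: "?a \<in> J" by (rule right_ideal_negative_mode[OF J a])
    have "Y (Y ?a (- 1) b) (- 1 - int s) c \<in> J"
      using right_ideal_negative_mode[OF J right_ideal_negative_mode[OF J aJ, of 0 b], of s c] by simp
    moreover have "divided_modes ?a b 0 (- 1 - int s) c \<in> J"
      unfolding divided_modes_def using right_ideal_negative_mode[OF J aJ]
      by (intro subspace_sum[OF sJ]) simp
    ultimately have "divided_modes b ?a (- 1 - int s) 0 c \<in> J"
      unfolding normally_ordered_modes using subspace_diff[OF sJ] by fastforce
    have "divided_modes b ?a (- 1 - int s) 0 c = (\<Sum>i<n + L. Y b (- 1 - int s - 1 - int i) (Y ?a (0 + int i) c))"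
    proof (rule divided_modes_finite_sum)
      fix j assume "n + L \<le> j"
      then have "Y a (int j - int n) c = 0" using L[of "j - n"] by (simp add: of_nat_diff)
      then show "Y ?a (0 + int j) c = 0" by (simp add: Y_divided_power)
    qed
    also have "\<dots> = (\<Sum>i\<in>{n..<n + L}. Y b (- 1 - int s - 1 - int i) (Y ?a (0 + int i) c))"
      by (rule sum.mono_neutral_right)
        (auto simp: Y_divided_power binomial_gbinomial[symmetric] Y_right)
    also have "\<dots> = (\<Sum>i<L. Y b (- 1 - int s - 1 - int (n + i)) (Y ?a (0 + int (n + i)) c))"
      by (rule sum.reindex_bij_witness[of _ "\<lambda>i. n + i" "\<lambda>i. i - n"]) auto
    also have "\<dots> = scale ((-1) ^ n) (\<Sum>i<L. scale (of_nat ((n + i) choose i)) (Y b (- 2 - int M - int i) (Y a (int i) c)))"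
      unfolding scale_sum_right
    proof (rule sum.cong)
      fix i
      have "of_int (0 + int (n + i)) gchoose n = (of_nat ((n + i) choose i) :: complex)"
        using binomial_symmetric[of i "n + i"] by (simp add: binomial_gbinomial)
      moreover have "- 1 - int s - 1 - int (n + i) = - 2 - int M - int i" "0 + int (n + i) - int n = int i"
        by (simp_all add: s)
      ultimately show "Y b (- 1 - int s - 1 - int (n + i)) (Y ?a (0 + int (n + i)) c)
        = scale ((-1) ^ n) (scale (of_nat ((n + i) choose i)) (Y b (- 2 - int M - int i) (Y a (int i) c)))"
        by (simp only: Y_divided_power Y_right scale_scale)
    qed simp
    finally have "scale ((-1) ^ n) (divided_modes b ?a (- 1 - int s) 0 c)
      = (\<Sum>i<L. scale (of_nat ((n + i) choose i)) (Y b (- 2 - int M - int i) (Y a (int i) c)))"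
      by (simp add: power_mult_distrib[symmetric])
    then show "(\<Sum>i<L. scale (of_nat ((n + i) choose i)) (Y b (- 2 - int M - int i) (Y a (int i) c))) \<in> J"
      using subspace_scale[OF sJ \<open>divided_modes b ?a (- 1 - int s) 0 c \<in> J\<close>, of "(-1) ^ n"] by simp
  qed
  then have main: "Y b (- 2 - int M - int i) (Y a (int i) c) \<in> J" if "L \<le> M" for M b
    using that L[of i] by (cases "i < L") (simp_all add: Y_right subspace_0[OF sJ])
  show ?thesis
  proof (intro exI allI impI)
    fix M b assume "L + i + 1 \<le> M"
    then show "Y b (- 1 - int M) (Y a (int i) c) \<in> J"
      using main[of "M - i - 1" b] by (simp add: of_nat_diff algebra_simps)
  qed
qed

text \<open>
  It suffices to write the vacuum as a combination of vectors \<open>a\<^bsub>(i)\<^esub> c\<close> with \<open>a \<in> J\<close> and \<open>i \<ge> 0\<close>. By simplicity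
  it is one if negative \<open>i\<close> are allowed; but those products lie in \<open>J\<close>, and if the vacuum is not in \<open>J\<close>, no
  nonzero element of \<open>J\<close> has weight zero.
\<close>
theorem right_ideal_contains_high_derivatives:
  assumes simple and J: "right_ideal J" and "J \<noteq> {0}"
  shows "\<exists>K. \<forall>M\<ge>K. \<forall>b. Y b (- 1 - int M) vac \<in> J"
proof (cases "vac \<in> J")
  case True
  then have "b \<in> J" for b using right_ideal_negative_mode[OF J, of vac 0 b] by (simp add: vacuum_left)
  then show ?thesis by blast
next
  case False
  note sJ = right_ideal_subspace[OF J]
  let ?W = "span {Y a n c | a n c. a \<in> J}"
  let ?P = "span {Y a (int i) c | a i c. a \<in> J}"
  (* gr 0 is spanned by the vacuum *)
  have J0: "x = 0" if x: "x \<in> J" "x \<in> gr 0" for x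
  proof (rule ccontr)
    assume "x \<noteq> 0"
    obtain c where c: "x = scale c vac" using x(2) gr_0 by auto
    then have "scale (inverse c) x = vac" using \<open>x \<noteq> 0\<close> by auto
    then show False using subspace_scale[OF sJ x(1), of "inverse c"] False by simp
  qed
  have comp: "component m x \<in> J" if "x \<in> J" for m x
    using that J by (intro component_mem) (simp_all add: right_ideal_def)
  have gen: "component 0 (Y a n c) \<in> ?P" if a: "a \<in> J" for a n c
  proof (cases "n < 0")
    case True
    then have "Y a n c \<in> J" using right_ideal_negative_mode[OF J a, of "nat (- 1 - n)" c] by simp
    then have "component 0 (Y a n c) = 0" by (intro J0 comp component_gr)
    then show ?thesis by (simp add: span_zero)
  next
    case False
    obtain A where A: "a = (\<Sum>p\<in>A. component p a)" using component_decomposition[of a] by metis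
    obtain B where B: "c = (\<Sum>q\<in>B. component q c)" using component_decomposition[of c] by metis
    have "component 0 (Y (component p a) n (component q c)) \<in> ?P" for p q
    proof -
      let ?y = "Y (component p a) n (component q c)"
      have "?y = Y (component p a) (int (nat n)) (component q c)" using False by simp
      then have "?y \<in> ?P" using comp[OF a, of p] by (intro span_base) blast
      moreover have "component 0 ?y \<in> {?y, 0}"
        using Y_gr_int[OF component_gr[of p a] component_gr[of q c], of n]
        by (auto simp: gr_int_def component_homogeneous component_zero split: if_splits)
      ultimately show ?thesis using span_zero by auto
    qed
    moreover have "Y a n c = (\<Sum>p\<in>A. \<Sum>q\<in>B. Y (component p a) n (component q c))"
    proof -
      have "Y (\<Sum>p\<in>A. component p a) n (\<Sum>q\<in>B. component q c)
        = (\<Sum>p\<in>A. \<Sum>q\<in>B. Y (component p a) n (component q c))"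
        unfolding Y_left(5) unfolding Y_right(5) ..
      then show ?thesis unfolding A[symmetric] B[symmetric] .
    qed
    ultimately show ?thesis by (simp add: component_sum span_sum)
  qed
  have WP: "component 0 w \<in> ?P" if "w \<in> ?W" for w using that
  proof (induction rule: span_induct_alt)
    case base
    then show ?case by (simp add: component_zero span_zero)
  next
    case (step r x y)
    then have "component 0 x \<in> ?P" using gen by blast
    with step show ?case by (simp add: component_add component_scale span_add span_scale)
  qed
  obtain a where a: "a \<in> J" "a \<noteq> 0" using assms(3) subspace_0[OF sJ] by blast
  have "Y a (- 1) vac \<in> ?W" using a(1) by (intro span_base) blast
  then have "?W \<noteq> {0}" using a(2) by (auto simp: vacuum_creation)
  then have "?W = UNIV" using assms(1) products_span_ideal unfolding simple_def by blast
  then have "component 0 vac \<in> ?P" using WP by blast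
  then have "vac \<in> ?P" using unit_gr by (simp add: component_homogeneous)
  moreover have "\<exists>K. \<forall>M\<ge>K. \<forall>b. Y b (- 1 - int M) x \<in> J" if "x \<in> ?P" for x using that
  proof (induction rule: span_induct_alt)
    case base
    then show ?case by (simp add: Y_right subspace_0[OF sJ])
  next
    case (step r x y)
    then obtain K1 where K1: "\<forall>M\<ge>K1. \<forall>b. Y b (- 1 - int M) x \<in> J" using deep_modes_mem[OF J] by blast
    obtain K2 where K2: "\<forall>M\<ge>K2. \<forall>b. Y b (- 1 - int M) y \<in> J" using step by blast
    show ?case using K1 K2
      by (intro exI[of _ "max K1 K2"]) (simp add: Y_right subspace_add[OF sJ] subspace_scale[OF sJ])
  qed
  ultimately show ?thesis by blast
qed

section \<open>The weight filtration\<close>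

text \<open>
  Products of negative modes, in which \<open>a\<^bsub>(-1-k)\<^esub>\<close> counts with the weight of \<open>a\<close>, whatever \<open>k\<close> is. The bound is an
  integer because brackets lower it by one: below zero the filtration vanishes.
\<close>
inductive mode_string :: "int \<Rightarrow> 'v \<Rightarrow> bool" where
  vacuum_string: "0 \<le> p \<Longrightarrow> mode_string p vac"
| string_step: "mode_string p w \<Longrightarrow> a \<in> gr n \<Longrightarrow> mode_string (p + int n) (Y a (- 1 - int k) w)"

definition Fil :: "int \<Rightarrow> 'v set" where "Fil p = span {w. mode_string p w}"

lemma mode_string_mono: "mode_string p w \<Longrightarrow> p \<le> q \<Longrightarrow> mode_string q w"
proof (induction arbitrary: q rule: mode_string.induct)
  case (string_step p w a n k)
  then show ?case using mode_string.string_step[of "q - int n" w a n k] by simp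
qed (simp add: vacuum_string)

lemma mode_string_nonneg: "mode_string p w \<Longrightarrow> 0 \<le> p"
  by (induction rule: mode_string.induct) simp_all

lemma subspace_Fil: "subspace (Fil p)"
  by (simp add: Fil_def)

lemma Fil_mono: "w \<in> Fil p \<Longrightarrow> p \<le> q \<Longrightarrow> w \<in> Fil q"
  unfolding Fil_def using span_mono[of "{w. mode_string p w}" "{w. mode_string q w}"] mode_string_mono by blast

lemma Fil_negative: "p < 0 \<Longrightarrow> w \<in> Fil p \<Longrightarrow> w = 0"
proof -
  assume "p < 0" "w \<in> Fil p"
  then have "{w. mode_string p w} = {}" using mode_string_nonneg by force
  then show "w = 0" using \<open>w \<in> Fil p\<close> by (simp add: Fil_def)
qed

lemma mode_string_Fil: "mode_string p w \<Longrightarrow> w \<in> Fil p"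
  by (simp add: Fil_def span_base)

lemma Fil_step: "w \<in> Fil p \<Longrightarrow> a \<in> gr n \<Longrightarrow> Y a (- 1 - int k) w \<in> Fil (p + int n)"
  unfolding Fil_def[of p]
  by (rule span_map_mem) (auto simp: Y_right subspace_Fil intro!: mode_string_Fil string_step)

lemma gr_Fil: "a \<in> gr n \<Longrightarrow> a \<in> Fil (int n)"
  using Fil_step[of vac 0 a n 0] mode_string_Fil[OF vacuum_string[of 0]] by (simp add: vacuum_creation)

lemma Fil_T: "w \<in> Fil p \<Longrightarrow> T w \<in> Fil p"
proof -
  have "T w \<in> Fil p" if "mode_string p w" for w p using that
  proof (induction rule: mode_string.induct)
    case (vacuum_string p)
    then show ?case by (simp add: T_vac subspace_0 subspace_Fil)
  next
    case (string_step p w a n k)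
    have "T (Y a (- 1 - int k) w) = Y a (- 1 - int k) (T w) + scale (of_nat (Suc k)) (Y a (- 1 - int (Suc k)) w)"
      using translation_commutator[of a "- 1 - int k" w] by (simp add: algebra_simps)
    moreover have "Y a (- 1 - int k) (T w) \<in> Fil (p + int n)" by (rule Fil_step) (use string_step in auto)
    moreover have "Y a (- 1 - int (Suc k)) w \<in> Fil (p + int n)"
      by (rule Fil_step[OF mode_string_Fil]) (use string_step in auto)
    ultimately show ?case by (simp del: of_nat_Suc add: subspace_add subspace_scale subspace_Fil)
  qed
  then show "w \<in> Fil p \<Longrightarrow> T w \<in> Fil p"
    unfolding Fil_def[of p] using subspace_span
    by (elim span_map_mem[of w _ T]) (auto simp: T_simps Fil_def)
qed

text \<open>
  The hypothesis on nonnegative modes holds for all \<open>w \<in> Fil p\<close>, which is the next lemma; it is a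
  hypothesis here since the proof of that lemma, by induction on strings, uses this one for shorter
  strings.
\<close>
lemma product_mode_Fil:
  assumes a: "a \<in> gr n" and b: "b \<in> gr m"
    and lower: "\<And>n' c i. c \<in> gr n' \<Longrightarrow> Y c (int i) w \<in> Fil (p + int n' - 1)"
    and w: "w \<in> Fil p"
  shows "Y (Y a (int j) b) l w \<in> Fil (p + int n + int m - 1)"
proof -
  let ?k = "int n + int m - int j - 1"
  have x: "Y a (int j) b \<in> gr_int ?k" using Y_gr_int[OF a b, of "int j"] by simp
  show ?thesis
  proof (cases "?k < 0")
    case True
    then show ?thesis using x by (simp add: gr_int_def Y_left subspace_0 subspace_Fil)
  next
    case False
    then have x': "Y a (int j) b \<in> gr (nat ?k)" using x by (simp add: gr_int_def)
    show ?thesis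
    proof (cases "l \<ge> 0")
      case True
      then show ?thesis using lower[OF x', of "nat l"] False by (auto intro: Fil_mono)
    next
      case l: False
      then show ?thesis using Fil_step[OF w x', of "nat (- 1 - l)"] False by (auto intro: Fil_mono)
    qed
  qed
qed

lemma Fil_nonneg_mode:
  assumes "w \<in> Fil p" "a \<in> gr n" shows "Y a (int j) w \<in> Fil (p + int n - 1)"
proof -
  have "Y a (int j) w \<in> Fil (p + int n - 1)" if "mode_string p w" "a \<in> gr n" for w p a n j using that
  proof (induction arbitrary: a n j rule: mode_string.induct)
    case (vacuum_string p)
    then show ?case by (simp add: vacuum_regular subspace_0 subspace_Fil)
  next
    case (string_step p w b m k)
    let ?l = "- 1 - int k"
    have "Y a (int j) (Y b ?l w) - Y b ?l (Y a (int j) w) \<in> Fil (p + int n + int m - 1)"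
      by (intro commutator_mem subspace_Fil product_mode_Fil string_step mode_string_Fil)
    moreover have "Y b ?l (Y a (int j) w) \<in> Fil (p + int n - 1 + int m)"
      by (intro Fil_step string_step)
    ultimately have "(Y a (int j) (Y b ?l w) - Y b ?l (Y a (int j) w)) + Y b ?l (Y a (int j) w)
        \<in> Fil (p + int m + int n - 1)"
      by (intro subspace_add subspace_Fil) (simp_all add: algebra_simps)
    then show ?case by simp
  qed
  then show ?thesis using assms(2)
    by (intro span_map_mem[of w "{w. mode_string p w}" "Y a (int j)"])
      (use assms(1) in \<open>auto simp: Fil_def[symmetric] Y_right subspace_Fil\<close>)
qed

lemma Fil_mode:
  assumes "w \<in> Fil p" "a \<in> gr n" shows "Y a k w \<in> Fil (p + int n)"
proof (cases "k \<ge> 0")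
  case True
  then show ?thesis using Fil_nonneg_mode[OF assms, of "nat k"] Fil_mono by simp
next
  case False
  then show ?thesis using Fil_step[OF assms, of "nat (- 1 - k)"] by simp
qed

lemma Fil_commutator:
  assumes "w \<in> Fil p" "a \<in> gr n" "b \<in> gr m"
  shows "Y a k (Y b l w) - Y b l (Y a k w) \<in> Fil (p + int n + int m - 1)"
  by (intro commutator_mem subspace_Fil product_mode_Fil assms Fil_nonneg_mode)

lemma Fil_divided_power: "w \<in> Fil p \<Longrightarrow> Y w (- 1 - int i) vac \<in> Fil p"
proof -
  assume "w \<in> Fil p"
  then have "(T ^^ i) w \<in> Fil p" by (induction i) (simp_all add: Fil_T)
  then have "scale (inverse (fact i)) ((T ^^ i) w) \<in> Fil p" by (intro subspace_scale subspace_Fil)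
  then show ?thesis by (simp add: T_pow_vacuum)
qed

lemma divided_power_left: "Y (Y a (- 1 - int d) vac) (- 1) w = Y a (- 1 - int d) w"
proof -
  have "(- 1 gchoose d :: complex) = (- 1) ^ d"
    using gbinomial_minus[of "1 :: complex" d] by (simp add: binomial_gbinomial[symmetric])
  then show ?thesis by (simp add: Y_divided_power power_mult_distrib[symmetric])
qed

text \<open>
  In weak skew-symmetry, the difference consists of nonnegative modes of \<open>x\<close>. They are multiples of
  nonnegative modes of \<open>s\<close> and therefore lower the filtration.
\<close>
lemma Fil_swap:
  assumes f: "f \<in> Fil q" and s: "s \<in> gr n" and x: "x = Y s (- 1 - int d) vac"
  shows "Y f (- 1) x - Y x (- 1) f \<in> Fil (q + int n - 1)"
proof -
  obtain N where N: "\<And>m. Y f m x =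
    (\<Sum>j\<le>N. scale ((-1) ^ j * of_nat (N choose j)) (Y x (int j - 1) (Y f (m - int j) vac)))"
    by (rule skew_symmetry_weak[of f x]) blast
  let ?R = "\<Sum>j<N. scale ((-1) ^ Suc j * of_nat (N choose Suc j)) (Y x (int j) (Y f (- 1 - int (Suc j)) vac))"
  have "Y x (int j) w \<in> Fil (q + int n - 1)" if "w \<in> Fil q" for j w
  proof (cases "j < d")
    case True
    then have "(of_int (int j) :: complex) gchoose d = 0" by (simp add: binomial_gbinomial[symmetric])
    then show ?thesis by (simp add: x Y_divided_power subspace_0 subspace_Fil)
  next
    case False
    then show ?thesis using Fil_nonneg_mode[OF that s, of "j - d"]
      by (simp add: x Y_divided_power subspace_scale subspace_Fil of_nat_diff)
  qed
  then have "?R \<in> Fil (q + int n - 1)"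
    using Fil_divided_power[OF f] by (intro subspace_sum subspace_Fil subspace_scale) blast
  moreover have "Y f (- 1) x = Y x (- 1) f + ?R"
    unfolding N lessThan_Suc_atMost[symmetric] sum.lessThan_Suc_shift by (simp add: vacuum_creation)
  ultimately show ?thesis by simp
qed

text \<open>
  A divided power of a homogeneous vector is counted with the weight of this vector, so that
  differentiation does not raise it.
\<close>
definition filtered_generator :: "nat \<Rightarrow> 'v \<Rightarrow> bool" where
  "filtered_generator n x \<longleftrightarrow> (\<exists>s\<in>gr n. \<exists>d. x = Y s (- 1 - int d) vac)"

lemma generator_Fil: "filtered_generator n x \<Longrightarrow> w \<in> Fil p \<Longrightarrow> Y x (- 1) w \<in> Fil (p + int n)"
  by (auto simp: filtered_generator_def divided_power_left intro: Fil_step)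

lemma generator_commutator:
  "filtered_generator n x \<Longrightarrow> filtered_generator m y \<Longrightarrow> w \<in> Fil p
    \<Longrightarrow> Y x (- 1) (Y y (- 1) w) - Y y (- 1) (Y x (- 1) w) \<in> Fil (p + int n + int m - 1)"
  by (auto simp: filtered_generator_def divided_power_left intro: Fil_commutator)

lemma generator_swap:
  "filtered_generator n x \<Longrightarrow> f \<in> Fil q \<Longrightarrow> Y f (- 1) x - Y x (- 1) f \<in> Fil (q + int n - 1)"
  by (auto simp: filtered_generator_def intro: Fil_swap)

lemma gr_0_cases: assumes "a \<in> gr 0" obtains c where "a = scale c vac"
  using assms gr_0 by auto

lemma T_pow_gr: "a \<in> gr n \<Longrightarrow> (T ^^ i) a \<in> gr (n + i)"
  by (induction i) (simp_all add: D_gr)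

lemma normally_ordered_products_homogeneous:
  assumes S: "\<And>s. s \<in> S \<Longrightarrow> \<exists>n. s \<in> gr n" and "a \<in> normally_ordered_products S"
  shows "\<exists>n. a \<in> gr n"
  using assms(2)
proof (induction rule: normally_ordered_products.induct)
  case empty_product
  then show ?case using unit_gr by blast
next
  case (derivative s i)
  then show ?case using S T_pow_gr by blast
next
  case (product a b)
  then show ?case using prd_gr by blast
qed

lemma gr_spanned_by_products:
  assumes S: "\<And>s. s \<in> S \<Longrightarrow> \<exists>n. s \<in> gr n" and span: "span (normally_ordered_products S) = UNIV"
    and a: "a \<in> gr n"
  shows "a \<in> span (normally_ordered_products S \<inter> gr n)"
proof -
  have "a \<in> span (normally_ordered_products S)" using span by simp
  then have "component n a \<in> span (normally_ordered_products S \<inter> gr n)"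
  proof (rule span_map_mem)
    fix b assume b: "b \<in> normally_ordered_products S"
    then obtain m where "b \<in> gr m" using normally_ordered_products_homogeneous[OF S] by blast
    then show "component n b \<in> span (normally_ordered_products S \<inter> gr n)"
      using b by (auto simp: component_homogeneous span_zero intro: span_base)
  qed (simp_all add: component_add component_scale)
  then show ?thesis using a by (simp add: component_homogeneous)
qed

end

section \<open>Words in the generators\<close>

text \<open>
  Monomials are formed from the \<open>x i\<close> with \<open>i < r\<close>; beyond \<open>r\<close> one can put \<open>x i = 0\<close>.
\<close>
locale filtered_generators = vertex_operator_algebra scale Y vac T gr
  for scale :: "complex \<Rightarrow> 'v::ab_group_add \<Rightarrow> 'v"
    and Y :: "'v \<Rightarrow> int \<Rightarrow> 'v \<Rightarrow> 'v"
    and vac :: 'v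
    and T :: "'v \<Rightarrow> 'v"
    and gr :: "nat \<Rightarrow> 'v set" +
  fixes x :: "nat \<Rightarrow> 'v" and wt :: "nat \<Rightarrow> nat" and r :: nat
  assumes generators_filtered: "\<And>i. filtered_generator (wt i) (x i)"
begin

definition word :: "nat list \<Rightarrow> 'v" where
  "word ws = foldr (\<lambda>i w. Y (x i) (- 1) w) ws vac"

lemma word_simps: "word [] = vac" "word (i # ws) = Y (x i) (- 1) (word ws)"
  by (simp_all add: word_def)

definition weight :: "nat multiset \<Rightarrow> int" where
  "weight M = (\<Sum>i\<in>#M. int (wt i))"

lemma weight_simps:
  "weight {#} = 0" "weight (add_mset i M) = int (wt i) + weight M"
  "weight (M + N) = weight M + weight N"
  by (simp_all add: weight_def)

lemma word_Fil: "word ws \<in> Fil (weight (mset ws))"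
proof (induction "ws")
  case Nil
  then show ?case by (simp add: word_simps weight_simps mode_string_Fil vacuum_string)
next
  case (Cons i "ws")
  then show ?case using generator_Fil[OF generators_filtered Cons, of i] by (simp add: word_simps weight_simps add.commute)
qed

text \<open>
  Moving one letter to the front; permuting a word is a repetition of this.
\<close>
lemma word_move:
  "word (us @ i # vs) - word (i # us @ vs) \<in> Fil (weight (mset (us @ i # vs)) - 1)"
proof (induction us)
  case Nil
  then show ?case by (simp add: subspace_0 subspace_Fil)
next
  case (Cons u us)
  have "Y (x u) (- 1) (word (us @ i # vs) - word (i # us @ vs))
      + (Y (x u) (- 1) (Y (x i) (- 1) (word (us @ vs))) - Y (x i) (- 1) (Y (x u) (- 1) (word (us @ vs))))
      \<in> Fil (weight (mset ((u # us) @ i # vs)) - 1)"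
    using generator_Fil[OF generators_filtered Cons, of u] generator_commutator[OF generators_filtered[of u] generators_filtered[of i] word_Fil[of "us @ vs"]]
    by (intro subspace_add subspace_Fil) (simp_all add: weight_simps algebra_simps)
  then show ?case by (simp add: word_simps Y_right)
qed

lemma word_permute:
  "mset ws = mset js \<Longrightarrow> word ws - word js \<in> Fil (weight (mset ws) - 1)"
proof (induction "ws" arbitrary: js)
  case Nil
  then show ?case by (simp add: subspace_0 subspace_Fil)
next
  case (Cons i "ws")
  then obtain us vs where js: "js = us @ i # vs" by (metis list.set_intros(1) set_mset_mset split_list)
  then have "mset ws = mset (us @ vs)" using Cons.prems by simp
  then have IH: "word ws - word (us @ vs) \<in> Fil (weight (mset ws) - 1)" by (rule Cons.IH)
  let ?W = "weight (mset (i # ws)) - 1"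
  have e1: "Y (x i) (- 1) (word ws - word (us @ vs)) \<in> Fil ?W"
    using generator_Fil[OF generators_filtered IH, of i] by (simp add: weight_simps algebra_simps)
  have e2: "word (us @ i # vs) - word (i # us @ vs) \<in> Fil ?W"
    using word_move[of us i vs] Cons.prems js by simp
  have "Y (x i) (- 1) (word ws - word (us @ vs)) - (word (us @ i # vs) - word (i # us @ vs)) \<in> Fil ?W"
    by (rule subspace_diff[OF subspace_Fil e1 e2])
  then show ?case by (simp add: word_simps Y_right js)
qed

end

section \<open>Reduction modulo a right ideal\<close>

text \<open>
  The \<open>x i\<close> with \<open>i < r\<close> include all divided powers \<open>T\<^sup>d s / d!\<close> of strong generators \<open>s\<close> with \<open>d < K\<close>; those with
  \<open>d \<ge> K\<close> lie in \<open>J\<close>.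
\<close>
locale spanning_system = filtered_generators scale Y vac T gr x wt r
  for scale :: "complex \<Rightarrow> 'v::ab_group_add \<Rightarrow> 'v"
    and Y :: "'v \<Rightarrow> int \<Rightarrow> 'v \<Rightarrow> 'v"
    and vac :: 'v
    and T :: "'v \<Rightarrow> 'v"
    and gr :: "nat \<Rightarrow> 'v set"
    and x :: "nat \<Rightarrow> 'v" and wt :: "nat \<Rightarrow> nat" and r :: nat +
  fixes K :: nat and S J :: "'v set"
  assumes S_hom: "\<And>s. s \<in> S \<Longrightarrow> \<exists>n. s \<in> gr n"
    and S_span: "span (normally_ordered_products S) = UNIV"
    and enum: "\<And>s m d. s \<in> S \<Longrightarrow> s \<noteq> 0 \<Longrightarrow> s \<in> gr m \<Longrightarrow> d < K
      \<Longrightarrow> \<exists>i<r. x i = Y s (- 1 - int d) vac \<and> wt i = m"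
    and J_ideal: "right_ideal J"
    and high: "\<And>M b. K \<le> M \<Longrightarrow> Y b (- 1 - int M) vac \<in> J"
begin

text \<open>
  Elements of \<open>J\<close> enter with their filtration degree. This matters since \<open>J\<close> is not closed under left
  multiplication: moving a generator past \<open>j \<in> J\<close> costs a term that is smaller only relative to the
  degree of \<open>j\<close>.
\<close>
definition reduced :: "int \<Rightarrow> 'v set" where
  "reduced p = span (J \<inter> Fil p \<union> {word ws | ws. set ws \<subseteq> {..<r} \<and> weight (mset ws) \<le> p})"

lemma subspace_reduced: "subspace (reduced p)"
  by (simp add: reduced_def)

lemma reduced_mono: "p \<le> q \<Longrightarrow> reduced p \<subseteq> reduced q"
  unfolding reduced_def by (intro span_mono) (auto intro: Fil_mono order_trans)

text \<open>
  High derivatives of \<open>s\<close> are in \<open>J\<close>, hence so are their products with \<open>w\<close>. For the others, \<open>w\<close> is reduced by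
  hypothesis: words become longer words, and elements of \<open>J\<close> are multiplied on the right instead, up
  to lower terms.
\<close>
lemma generator_mode_reduced:
  assumes IH: "\<And>q. q < p \<Longrightarrow> Fil q \<subseteq> reduced q"
    and s: "s \<in> S" "s \<in> gr m" "1 \<le> m" and w: "w \<in> Fil (p - int m)"
  shows "Y s (- 1 - int d) w \<in> reduced p"
proof (cases "s = 0")
  case True
  then show ?thesis by (simp add: Y_left subspace_0 subspace_reduced)
next
  case False
  let ?y = "Y s (- 1 - int d) vac"
  have y: "Y s (- 1 - int d) w = Y ?y (- 1) w" for w by (rule divided_power_left[symmetric])
  have yFil: "Y ?y (- 1) w \<in> Fil p" if "w \<in> Fil (p - int m)" for w
    using Fil_step[OF that s(2), of d] unfolding divided_power_left by simp
  show ?thesis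
  proof (cases "d < K")
    case dK: False
    have "Y ?y (- 1) w \<in> J"
      using right_ideal_negative_mode[OF J_ideal high[of d s], of 0 w] dK by simp
    then show ?thesis using yFil[OF w] unfolding y[of w] reduced_def by (intro span_base) simp
  next
    case True
    then obtain i where i: "i < r" "x i = ?y" "wt i = m" using enum[OF s(1) False s(2)] by blast
    have "w \<in> reduced (p - int m)" using IH[of "p - int m"] w s(3) by auto
    then show ?thesis unfolding y[of w] reduced_def[of "p - int m"]
    proof (rule span_map_mem)
      fix v assume "v \<in> J \<inter> Fil (p - int m) \<union> {word ws | ws. set ws \<subseteq> {..<r} \<and> weight (mset ws) \<le> p - int m}"
      then consider "v \<in> J" "v \<in> Fil (p - int m)"
        | "ws" where "v = word ws" "set ws \<subseteq> {..<r}" "weight (mset ws) \<le> p - int m" by blast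
      then show "Y ?y (- 1) v \<in> reduced p"
      proof cases
        case 1
        have lower: "Y v (- 1) ?y - Y ?y (- 1) v \<in> Fil (p - 1)"
          using Fil_swap[OF 1(2) s(2) refl, of d] by simp
        then have "Y v (- 1) ?y \<in> Fil p"
          using subspace_add[OF subspace_Fil Fil_mono[OF lower, of p] yFil[OF 1(2)]] by simp
        moreover have "Y v (- 1) ?y \<in> J" using right_ideal_negative_mode[OF J_ideal 1(1), of 0] by simp
        ultimately have "Y v (- 1) ?y \<in> reduced p" unfolding reduced_def by (intro span_base) simp
        moreover have "Y v (- 1) ?y - Y ?y (- 1) v \<in> reduced p"
          using lower IH[of "p - 1"] reduced_mono[of "p - 1" p] by auto
        ultimately show ?thesis using subspace_diff[OF subspace_reduced] by fastforce
      next
        case 2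
        then have "Y ?y (- 1) v = word (i # ws)" "set (i # ws) \<subseteq> {..<r}" "weight (mset (i # ws)) \<le> p"
          using i by (simp_all add: word_simps weight_simps)
        then show ?thesis unfolding reduced_def by (intro span_base) blast
      qed
    qed (simp_all add: subspace_reduced Y_right)
  qed
qed

text \<open>
  By induction on the product: a mode of \<open>bc\<close> is a sum of products of a mode of \<open>b\<close> and one of \<open>c\<close> in
  either order, where the outer one is negative. The inner one moves \<open>w\<close> up
  in the filtration by at most its weight, so the hypothesis for the outer factor applies.
\<close>
lemma product_mode_reduced:
  assumes IH: "\<And>q. q < p \<Longrightarrow> Fil q \<subseteq> reduced q"
    and "a \<in> normally_ordered_products S" "a \<in> gr n" "1 \<le> n" "w \<in> Fil (p - int n)"
  shows "Y a (- 1 - int k) w \<in> reduced p"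
  using assms(2-)
proof (induction arbitrary: n w k rule: normally_ordered_products.induct)
  case empty_product
  then have "vac = 0" using component_homogeneous[of vac 0 0] component_homogeneous[of vac n 0] unit_gr by simp
  then have "Y vac (- 1 - int k) w = 0" by (metis Y_left(4))
  then show ?case by (simp add: subspace_0 subspace_reduced)
next
  case (derivative s i)
  obtain m where m: "s \<in> gr m" using S_hom derivative(1) by blast
  show ?case
  proof (cases "(T ^^ i) s = 0")
    case True
    then show ?thesis by (simp add: Y_left subspace_0 subspace_reduced)
  next
    case False
    have "n = m + i"
      using component_homogeneous[OF T_pow_gr[OF m, of i], of n] component_homogeneous[OF derivative(2), of n] False
      by (auto split: if_splits)
    moreover have "m \<noteq> 0"
    proof
      assume "m = 0"
      then obtain c where c: "s = scale c vac" using m gr_0_cases by blast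
      (* a scalar has no derivatives, and n is at least 1 *)
      have "i \<noteq> 0" using \<open>n = m + i\<close> \<open>m = 0\<close> derivative(3) by simp
      then obtain i' where "i = Suc i'" by (cases i) auto
      then have "(T ^^ i) s = (T ^^ i') (T s)" by (simp add: funpow_swap1)
      also have "\<dots> = 0" unfolding c by (induction i') (simp_all add: T_simps T_vac)
      finally show False using False by simp
    qed
    ultimately have "w \<in> Fil (p - int m)" using derivative(4) by (auto intro: Fil_mono)
    then have "Y s (- 1 - int (k + i)) w \<in> reduced p"
      using generator_mode_reduced[where p = p and d = "k + i", OF IH derivative(1) m] \<open>m \<noteq> 0\<close> by simp
    then show ?thesis
      by (simp add: T_pow_vacuum Y_left Y_divided_power subspace_scale subspace_reduced algebra_simps)
  qed
next
  case (product b c)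
  obtain n1 n2 where b: "b \<in> gr n1" and c: "c \<in> gr n2"
    using product(1,2) normally_ordered_products_homogeneous[OF S_hom] by metis
  show ?case
  proof (cases "b \<bullet> c = 0")
    case True
    then show ?thesis by (simp add: Y_left subspace_0 subspace_reduced)
  next
    case False
    have n: "n = n1 + n2"
      using component_homogeneous[OF prd_gr[OF b c], of n] component_homogeneous[OF product(5), of n] False
      by (auto split: if_splits)
    consider "n1 = 0" | "n2 = 0" | "1 \<le> n1" "1 \<le> n2" by linarith
    then show ?thesis
    proof cases
      case 1
      then obtain r where "b = scale r vac" using b gr_0_cases by blast
      then have "b \<bullet> c = scale r c" by (simp add: normally_ordered_def Y_left vacuum_left)
      then show ?thesis using product(4)[of n w k] c n 1 product(6,7)
        by (simp add: Y_left subspace_scale subspace_reduced)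
    next
      case 2
      then obtain r where "c = scale r vac" using c gr_0_cases by blast
      then have "b \<bullet> c = scale r b" by (simp add: normally_ordered_def Y_right vacuum_creation)
      then show ?thesis using product(3)[of n w k] b n 2 product(6,7)
        by (simp add: Y_left subspace_scale subspace_reduced)
    next
      case 3
      have "Y b (- 1 - int i) (Y c l w) \<in> reduced p" for i l
        using Fil_mode[OF product(7) c, of l] n by (intro product(3)[OF b 3(1)]) simp
      then have "divided_modes b c 0 (- 1 - int k) w \<in> reduced p"
        unfolding divided_modes_def by (intro subspace_sum subspace_reduced) simp
      moreover have "Y c (- 1 - int i) (Y b l w) \<in> reduced p" for i l
        using Fil_mode[OF product(7) b, of l] n by (intro product(4)[OF c 3(2)]) simp
      then have "Y c (- 1 - int k - 1 - int i) (Y b (0 + int i) w) \<in> reduced p" for i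
        by (metis (no_types, opaque_lifting) add.commute add_diff_eq diff_diff_add of_nat_1 of_nat_add)
      then have "divided_modes c b (- 1 - int k) 0 w \<in> reduced p"
        unfolding divided_modes_def by (intro subspace_sum subspace_reduced) simp
      ultimately show ?thesis
        unfolding normally_ordered_def normally_ordered_modes by (rule subspace_add[OF subspace_reduced])
    qed
  qed
qed

text \<open>
  A string is peeled from the left. Letters of weight zero are scalars; after a letter of positive
  weight comes a vector of smaller degree, for which reducibility is known.
\<close>
theorem Fil_reduced: "Fil p \<subseteq> reduced p"
proof (induction "nat p" arbitrary: p rule: less_induct)
  case less
  have IH: "Fil q \<subseteq> reduced q" if "q < p" for q
  proof (cases "q < 0")
    case True
    then show ?thesis using Fil_negative subspace_0[OF subspace_reduced] by blast
  next
    case False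
    then show ?thesis using less that by simp
  qed
  have strings: "w \<in> reduced p" if "mode_string q w" "q \<le> p" for w q using that
  proof (induction rule: mode_string.induct)
    case (vacuum_string q)
    then have "vac = word []" "set [] \<subseteq> {..<r}" "weight (mset []) \<le> p"
      by (simp_all add: word_simps weight_simps)
    then show ?case unfolding reduced_def by (intro span_base) blast
  next
    case (string_step q w a n k)
    show ?case
    proof (cases "n = 0")
      case True
      then obtain c where c: "a = scale c vac" using string_step(2) gr_0_cases by blast
      have "w \<in> reduced p" using string_step True by simp
      then show ?thesis
        by (simp add: c Y_left vacuum_left subspace_scale subspace_0 subspace_reduced)
    next
      case False
      have w: "w \<in> Fil (p - int n)"
        using mode_string_Fil[OF string_step(1)] string_step(4) by (auto intro: Fil_mono)
      have "a \<in> span (normally_ordered_products S \<inter> gr n)"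
        by (rule gr_spanned_by_products[OF S_hom S_span string_step(2)])
      then show ?thesis
      proof (rule span_map_mem[of a _ "\<lambda>a. Y a (- 1 - int k) w"])
        fix b assume "b \<in> normally_ordered_products S \<inter> gr n"
        then show "Y b (- 1 - int k) w \<in> reduced p"
          using product_mode_reduced[where p = p and a = b and n = n and w = w and k = k, OF IH] False w by simp
      qed (simp_all add: Y_left subspace_reduced)
    qed
  qed
  have "{w. mode_string p w} \<subseteq> reduced p" using strings[of p] by auto
  then show ?case unfolding Fil_def by (rule span_minimal[OF _ subspace_reduced])
qed

end

section \<open>Leading monomials of right ideals\<close>

context filtered_generators
begin

text \<open>
  The letters are sorted, which is a choice of no consequence: another order changes the word by
  terms of lower weight.
\<close>
definition monomial :: "nat multiset \<Rightarrow> 'v" where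
  "monomial M = word (sorted_list_of_multiset M)"

lemma monomial_Fil: "monomial M \<in> Fil (weight M)"
  using word_Fil[of "sorted_list_of_multiset M"] by (simp add: monomial_def)

lemma word_monomial: "word ws - monomial (mset ws) \<in> Fil (weight (mset ws) - 1)"
  unfolding monomial_def by (rule word_permute) simp

lemma generator_times_monomial:
  "Y (x i) (- 1) (monomial M) - monomial (add_mset i M) \<in> Fil (weight (add_mset i M) - 1)"
  using word_monomial[of "i # sorted_list_of_multiset M"] by (simp add: monomial_def word_simps)

definition monomials_of_weight :: "int \<Rightarrow> nat multiset set" where
  "monomials_of_weight p = {M. set_mset M \<subseteq> {..<r} \<and> weight M = p}"

text \<open>
  Monomials are compared by weight first and then by the multiset order on their letters, which is a
  well-order compatible with multiplication.
\<close>
definition lower_terms :: "nat multiset \<Rightarrow> 'v set" where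
  "lower_terms M = span (Fil (weight M - 1) \<union> monomial ` {M' \<in> monomials_of_weight (weight M). M' < M})"

lemma subspace_lower_terms: "subspace (lower_terms M)"
  by (simp add: lower_terms_def)

lemma Fil_lower_terms: "w \<in> Fil (weight M - 1) \<Longrightarrow> w \<in> lower_terms M"
  unfolding lower_terms_def by (rule span_base) simp

lemma lower_terms_Fil: "lower_terms M \<subseteq> Fil (weight M)"
proof -
  have "monomial M' \<in> Fil (weight M)" if "weight M' = weight M" for M'
    using monomial_Fil[of M'] that by simp
  then show ?thesis unfolding lower_terms_def
    by (intro span_minimal subspace_Fil) (auto simp: monomials_of_weight_def intro: Fil_mono)
qed

lemma generator_times_lower_terms:
  assumes "l \<in> lower_terms M" "i < r" shows "Y (x i) (- 1) l \<in> lower_terms (add_mset i M)"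
  using assms(1) unfolding lower_terms_def[of M]
proof (rule span_map_mem)
  fix u assume "u \<in> Fil (weight M - 1) \<union> monomial ` {M' \<in> monomials_of_weight (weight M). M' < M}"
  then consider "u \<in> Fil (weight M - 1)"
    | M' where "u = monomial M'" "M' \<in> monomials_of_weight (weight M)" "M' < M" by blast
  then show "Y (x i) (- 1) u \<in> lower_terms (add_mset i M)"
  proof cases
    case 1
    then show ?thesis using generator_Fil[OF generators_filtered 1, of i]
      by (intro Fil_lower_terms) (simp add: weight_simps algebra_simps)
  next
    case 2
    have "add_mset i M' < add_mset i M" using 2(3) by (metis add_mset_add_single add_strict_right_mono)
    moreover have "add_mset i M' \<in> monomials_of_weight (weight (add_mset i M))"
      using 2(2) assms(2) by (simp add: monomials_of_weight_def weight_simps)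
    ultimately have "monomial (add_mset i M') \<in> lower_terms (add_mset i M)"
      unfolding lower_terms_def by (intro span_base) blast
    moreover have "Y (x i) (- 1) u - monomial (add_mset i M') \<in> lower_terms (add_mset i M)"
      using generator_times_monomial[of i M'] 2(1,2)
      by (intro Fil_lower_terms) (simp add: weight_simps monomials_of_weight_def)
    ultimately show ?thesis using subspace_add[OF subspace_lower_terms] by fastforce
  qed
qed (simp_all add: Y_right subspace_lower_terms)

text \<open>
  Monomials need not be linearly independent, so an element can have many leading monomials.
\<close>
definition leading_monomials :: "'v set \<Rightarrow> nat multiset set" where
  "leading_monomials I = {M. set_mset M \<subseteq> {..<r} \<and> (\<exists>l\<in>lower_terms M. monomial M - l \<in> I)}"

text \<open>
  Multiplying an element of \<open>I\<close> by \<open>x i\<close> on the right is the same as multiplying it on the left, up to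
  lower terms.
\<close>
lemma leading_monomials_add:
  assumes I: "right_ideal I" and M: "M \<in> leading_monomials I" and i: "i < r"
  shows "add_mset i M \<in> leading_monomials I"
proof -
  obtain l where l: "l \<in> lower_terms M" "monomial M - l \<in> I"
    using M by (auto simp: leading_monomials_def)
  let ?f = "monomial M - l" and ?M = "add_mset i M"
  have f: "?f \<in> Fil (weight M)"
    using lower_terms_Fil l(1) by (intro subspace_diff subspace_Fil monomial_Fil) blast
  let ?e = "Y ?f (- 1) (x i) - Y (x i) (- 1) ?f"
  let ?d = "Y (x i) (- 1) (monomial M) - monomial ?M"
  have e: "?e \<in> lower_terms ?M"
    using generator_swap[OF generators_filtered f, of i] by (intro Fil_lower_terms) (simp add: weight_simps add.commute)
  have d: "?d \<in> lower_terms ?M"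
    by (intro Fil_lower_terms generator_times_monomial)
  have "Y (x i) (- 1) l - ?d - ?e \<in> lower_terms ?M"
    by (intro subspace_diff[OF subspace_lower_terms] e d generator_times_lower_terms l(1) i)
  moreover have "monomial ?M - (Y (x i) (- 1) l - ?d - ?e) = Y ?f (- 1) (x i)"
    by (simp add: Y_right)
  moreover have "Y ?f (- 1) (x i) \<in> I" using right_ideal_negative_mode[OF I l(2), of 0] by simp
  ultimately have "\<exists>l\<in>lower_terms ?M. monomial ?M - l \<in> I" by metis
  then show ?thesis using M i by (simp add: leading_monomials_def)
qed

lemma leading_monomials_upward:
  assumes I: "right_ideal I" and "M \<in> leading_monomials I" "M \<subseteq># M'" "set_mset M' \<subseteq> {..<r}"
  shows "M' \<in> leading_monomials I"
proof -
  have "M + A \<in> leading_monomials I" if "set_mset A \<subseteq> {..<r}" for A using that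
    by (induction A) (simp_all add: assms(2) leading_monomials_add[OF I])
  from this[of "M' - M"] show ?thesis
    using assms(3,4) by (metis in_diffD subset_mset.add_diff_inverse subsetD subsetI)
qed

end

context spanning_system
begin

text \<open>
  As in the theory of Groebner bases: an element of \<open>I\<close> is reduced by subtracting an element of \<open>I'\<close> with
  the same leading monomial. This terminates, by induction on the weight and, for equal weight,
  on the monomial.
\<close>
lemma same_leading_monomials_eq:
  assumes I: "right_ideal I" and I': "right_ideal I'" and "I' \<subseteq> I" and "J \<subseteq> I'"
    and leading: "leading_monomials I \<subseteq> leading_monomials I'"
  shows "I \<subseteq> I'"
proof -
  note J = right_ideal_subspace[OF J_ideal] and sI = right_ideal_subspace[OF I] and sI' = right_ideal_subspace[OF I']
  have Fil_case: "I \<inter> Fil p \<subseteq> I'" for p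
  proof (induction "nat p" arbitrary: p rule: less_induct)
    case less
    show ?case
    proof (cases "p < 0")
      case True
      then show ?thesis using Fil_negative subspace_0[OF sI'] by blast
    next
      case False
      have IH: "I \<inter> Fil (p - 1) \<subseteq> I'"
      proof (cases "p = 0")
        case True
        then show ?thesis using Fil_negative[of "p - 1"] subspace_0[OF sI'] by auto
      next
        case False
        then show ?thesis using less[of "p - 1"] \<open>\<not> p < 0\<close> by simp
      qed
      let ?B = "J \<union> Fil (p - 1)" and ?X = "monomials_of_weight p"
      let ?S = "\<lambda>M. ?B \<union> monomial ` {M' \<in> ?X. M' < M}"
      have base: "f \<in> I'" if f: "f \<in> I" "f \<in> span ?B" for f
      proof -
        obtain j e where je: "f = j + e" "j \<in> J" "e \<in> Fil (p - 1)"
          using f(2) J subspace_Fil unfolding span_Un by (auto simp: span_eq_iff[THEN iffD2])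
        have "j \<in> I'" using je(2) assms(4) by blast
        moreover have "e \<in> I"
          using subspace_diff[OF sI f(1), of j] je \<open>j \<in> I'\<close> assms(3) by auto
        ultimately show ?thesis using je IH subspace_add[OF sI'] by blast
      qed
      have lead: "f \<in> I'" if "M \<in> ?X" "f \<in> I" "f \<in> span (insert (monomial M) (?S M))" for M f
        using that
      proof (induction M arbitrary: f rule: less_induct)
        case (less M)
        (* the induction hypothesis for elements that involve only monomials below M *)
        have below: "h \<in> I'" if h: "h \<in> I" "h \<in> span (?S M)" for h
        proof -
          from span_leading[OF h(2)] show ?thesis
          proof
            assume "h \<in> span ?B"
            then show ?thesis using base h(1) by blast
          next
            assume "\<exists>a\<in>{M' \<in> ?X. M' < M}. h \<in> span (insert (monomial a)
              (?B \<union> monomial ` {b \<in> {M' \<in> ?X. M' < M}. b < a}))"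
            then obtain a where a: "a \<in> ?X" "a < M"
              "h \<in> span (insert (monomial a) (?B \<union> monomial ` {b \<in> {M' \<in> ?X. M' < M}. b < a}))"
              by blast
            have "h \<in> span (insert (monomial a) (?S a))"
              using span_mono[of "insert (monomial a) (?B \<union> monomial ` {b \<in> {M' \<in> ?X. M' < M}. b < a})"
                  "insert (monomial a) (?S a)"] a(3) by auto
            then show ?thesis using less.IH a h(1) by blast
          qed
        qed
        obtain c where c: "f - scale c (monomial M) \<in> span (?S M)"
          using less.prems(3) unfolding span_breakdown_eq by blast
        show ?case
        proof (cases "c = 0")
          case True
          then show ?thesis using below less.prems(2) c by simp
        next
          case False
          have wM: "weight M = p" using less.prems(1) by (simp add: monomials_of_weight_def)
          have lower_sub: "lower_terms M \<subseteq> span (?S M)"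
            unfolding lower_terms_def wM by (rule span_mono) blast
          let ?f = "scale (inverse c) f"
          have "scale (inverse c) (f - scale c (monomial M)) \<in> span (?S M)" using c by (rule span_scale)
          then have "?f - monomial M \<in> span (J \<union> (Fil (p - 1) \<union> monomial ` {M' \<in> ?X. M' < M}))"
            using False by (simp add: scale_right_diff_distrib Un_assoc)
          then obtain j l where jl: "?f - monomial M = j + l" "j \<in> J" "l \<in> lower_terms M"
            using J unfolding span_Un[of J] lower_terms_def wM by (auto simp: span_eq_iff[THEN iffD2])
          (* the component j in J also lies in I and can be dropped *)
          have "?f - j \<in> I"
            using subspace_scale[OF sI less.prems(2)] jl(2) assms(3,4) by (intro subspace_diff[OF sI]) blast+
          moreover have "?f - j = monomial M - (- l)" using jl(1) by (simp add: algebra_simps)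
          moreover have "- l \<in> lower_terms M" using jl(3) subspace_neg[OF subspace_lower_terms] by blast
          ultimately have "M \<in> leading_monomials I"
            using less.prems(1) unfolding leading_monomials_def monomials_of_weight_def by force
          then obtain l' where l': "l' \<in> lower_terms M" "monomial M - l' \<in> I'"
            using leading by (auto simp: leading_monomials_def)
          let ?g = "scale c (monomial M - l')"
          have g: "?g \<in> I'" by (rule subspace_scale[OF sI' l'(2)])
          have "f - ?g \<in> I" using less.prems(2) g assms(3) by (intro subspace_diff[OF sI]) blast+
          moreover have "f - ?g \<in> span (?S M)"
          proof -
            have "(f - scale c (monomial M)) + scale c l' \<in> span (?S M)"
              using c l'(1) lower_sub by (intro span_add span_scale) blast+
            then show ?thesis by (simp add: scale_right_diff_distrib algebra_simps)
          qed
          ultimately have "f - ?g \<in> I'" by (rule below)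
          then have "f - ?g + ?g \<in> I'" by (rule subspace_add[OF sI' _ g])
          then show ?thesis by simp
        qed
      qed
      have cover: "Fil p \<subseteq> span (?B \<union> monomial ` ?X)"
      proof -
        have "word ws \<in> span (?B \<union> monomial ` ?X)" if "set ws \<subseteq> {..<r}" "weight (mset ws) \<le> p" for "ws"
        proof (cases "weight (mset ws) = p")
          case True
          have "word ws - monomial (mset ws) \<in> span (?B \<union> monomial ` ?X)"
            using word_monomial[of "ws"] True by (intro span_base) simp
          moreover have "monomial (mset ws) \<in> span (?B \<union> monomial ` ?X)"
            using True that(1) by (intro span_base) (simp add: monomials_of_weight_def)
          ultimately show ?thesis using span_add by fastforce
        next
          case False
          then have "word ws \<in> Fil (p - 1)"
            using Fil_mono[OF word_Fil[of "ws"], of "p - 1"] that(2) by simp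
          then show ?thesis by (intro span_base) simp
        qed
        then have "span (J \<inter> Fil p \<union> {word ws | ws. set ws \<subseteq> {..<r} \<and> weight (mset ws) \<le> p})
            \<subseteq> span (?B \<union> monomial ` ?X)"
          by (intro span_minimal subspace_span) (auto intro: span_base)
        then show ?thesis using Fil_reduced[of p] unfolding reduced_def by blast
      qed
      show ?thesis
      proof
        fix f assume f: "f \<in> I \<inter> Fil p"
        then have "f \<in> span (?B \<union> monomial ` ?X)" using cover by blast
        from span_leading[OF this] show "f \<in> I'" using base lead f by blast
      qed
    qed
  qed
  show ?thesis
  proof
    fix v assume v: "v \<in> I"
    obtain A where A: "v = (\<Sum>n\<in>A. component n v)" using component_decomposition[of v] by metis
    have "component n v \<in> I'" for n
    proof -
      have "component n v \<in> I" using I v by (intro component_mem) (simp_all add: right_ideal_def)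
      then show ?thesis using Fil_case gr_Fil[OF component_gr] by blast
    qed
    then have "(\<Sum>n\<in>A. component n v) \<in> I'" by (intro subspace_sum[OF sI'])
    then show "v \<in> I'" using A by simp
  qed
qed

end

context vertex_operator_algebra
begin

lemma homogeneous_strong_generators:
  assumes strongly_finitely_generated
  obtains S where "finite S" "\<And>s. s \<in> S \<Longrightarrow> \<exists>n. s \<in> gr n" "span (normally_ordered_products S) = UNIV"
proof -
  obtain S0 where S0: "finite S0" "span (normally_ordered_products S0) = UNIV"
    using assms unfolding strongly_finitely_generated_def by blast
  define S where "S = (\<Union>s\<in>S0. range (\<lambda>n. component n s))"
  have "finite (range (\<lambda>n. component n s))" for s
  proof -
    obtain A where "finite A" "\<And>n. n \<notin> A \<Longrightarrow> component n s = 0" using component_decomposition[of s] by metis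
    then show ?thesis using finite_subset[of "range (\<lambda>n. component n s)" "insert 0 ((\<lambda>n. component n s) ` A)"] by auto
  qed
  then have "finite S" using S0(1) by (simp add: S_def)
  moreover have "\<exists>n. s \<in> gr n" if "s \<in> S" for s using that component_gr by (auto simp: S_def)
  moreover have "a \<in> span (normally_ordered_products S)" if "a \<in> normally_ordered_products S0" for a
    using that
  proof (induction rule: normally_ordered_products.induct)
    case empty_product
    show ?case by (intro span_base normally_ordered_products.empty_product)
  next
    case (derivative s i)
    obtain A where A: "s = (\<Sum>n\<in>A. component n s)" using component_decomposition[of s] by metis
    have "(T ^^ i) (\<Sum>n\<in>A. component n s) = (\<Sum>n\<in>A. (T ^^ i) (component n s))"
      by (induction i) (simp_all add: T_simps)
    moreover have "(T ^^ i) (component n s) \<in> span (normally_ordered_products S)" for n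
      using derivative by (intro span_base normally_ordered_products.derivative) (auto simp: S_def)
    ultimately show ?case using A by (metis span_sum)
  next
    case (product a b)
    have "a' \<bullet> b \<in> span (normally_ordered_products S)" if a': "a' \<in> normally_ordered_products S" for a'
      using product(4)
    proof (rule span_map_mem)
      show "a' \<bullet> b' \<in> span (normally_ordered_products S)" if "b' \<in> normally_ordered_products S" for b'
        by (intro span_base normally_ordered_products.product a' that)
    qed (simp_all add: normally_ordered_def Y_right)
    with product(3) show ?case
      by (rule span_map_mem[of a _ "\<lambda>a. a \<bullet> b"]) (simp_all add: normally_ordered_def Y_left)
  qed
  then have "span (normally_ordered_products S) = UNIV"
    using S0(2) span_minimal[OF _ subspace_span] by (metis subsetI top.extremum_uniqueI)
  ultimately show ?thesis by (rule that)
qed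

theorem chain_above_nonzero_right_ideal:
  assumes simple strongly_finitely_generated
    and J: "right_ideal J" "J \<noteq> {0}" and I: "\<And>n. right_ideal (I n)" and JI: "\<And>n. J \<subseteq> I n"
    and chain: "\<And>n. I n \<subseteq> I (Suc n)"
  shows "\<exists>N. \<forall>n\<ge>N. I n = I N"
proof -
  obtain K where K: "\<And>M b. K \<le> M \<Longrightarrow> Y b (- 1 - int M) vac \<in> J"
    using right_ideal_contains_high_derivatives[OF assms(1) J] by blast
  obtain S where S: "finite S" "\<And>s. s \<in> S \<Longrightarrow> \<exists>n. s \<in> gr n" "span (normally_ordered_products S) = UNIV"
    using homogeneous_strong_generators[OF assms(2)] by metis
  have "finite ((S - {0}) \<times> {..<K})" using S(1) by simp
  then obtain ps where ps: "set ps = (S - {0}) \<times> {..<K}" using finite_list by blast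
  define r where "r = length ps"
  define x where "x i = (if i < r then Y (fst (ps ! i)) (- 1 - int (snd (ps ! i))) vac else 0)" for i
  define wt where "wt i = (if i < r then SOME n. fst (ps ! i) \<in> gr n else 0)" for i
  have wt: "fst (ps ! i) \<in> gr (wt i)" "fst (ps ! i) \<noteq> 0" if "i < r" for i
  proof -
    have "ps ! i \<in> (S - {0}) \<times> {..<K}" using that ps nth_mem unfolding r_def by blast
    then have "fst (ps ! i) \<in> S" and "fst (ps ! i) \<noteq> 0" by auto
    then show "fst (ps ! i) \<noteq> 0" and "fst (ps ! i) \<in> gr (wt i)"
      using someI_ex[OF S(2), of "fst (ps ! i)"] that by (simp_all add: wt_def)
  qed
  have gen: "filtered_generator (wt i) (x i)" for i
  proof (cases "i < r")
    case True
    then show ?thesis using wt(1) unfolding filtered_generator_def x_def by auto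
  next
    case False
    then have "x i = Y 0 (- 1 - int 0) vac" by (simp add: x_def Y_left)
    then show ?thesis unfolding filtered_generator_def using subspace_0[OF subspace_gr] by blast
  qed
  have enum: "\<exists>i<r. x i = Y s (- 1 - int d) vac \<and> wt i = m" if s: "s \<in> S" "s \<noteq> 0" "s \<in> gr m" "d < K" for s m d
  proof -
    have "(s, d) \<in> set ps" using s ps by simp
    then obtain i where i: "i < r" "ps ! i = (s, d)" unfolding r_def by (auto simp: in_set_conv_nth)
    then have "s \<in> gr (wt i)" using wt(1) by force
    then have "wt i = m"
      using component_homogeneous[OF s(3), of m] component_homogeneous[of s "wt i" m] s(2) by (auto split: if_splits)
    then show ?thesis using i by (intro exI[of _ i]) (simp add: x_def)
  qed
  interpret spanning_system scale Y vac T gr x wt r K S J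
    by unfold_locales (fact gen S(2) S(3) enum J(1) K)+
  let ?L = leading_monomials
  have L_chain: "?L (I n) \<subseteq> ?L (I (Suc n))" for n
    using chain[of n] unfolding leading_monomials_def by blast
  have L_sub: "set_mset M \<subseteq> {..<r}" if "M \<in> ?L (I n)" for M n
    using that unfolding leading_monomials_def by blast
  have "\<exists>N. \<forall>n\<ge>N. ?L (I n) = ?L (I N)"
    by (rule upward_closed_chain_stabilizes[of "\<lambda>n. ?L (I n)" r, OF L_sub leading_monomials_upward[OF I] L_chain])
  then obtain N where N: "\<And>n. n \<ge> N \<Longrightarrow> ?L (I n) = ?L (I N)" by blast
  have "I n = I N" if "n \<ge> N" for n
  proof
    show sub: "I N \<subseteq> I n" by (rule lift_Suc_mono_le[of I, OF chain that])
    show "I n \<subseteq> I N"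
      by (rule same_leading_monomials_eq[OF I I sub JI equalityD1[OF N[OF that]]])
  qed
  then show ?thesis by blast
qed

end

section \<open>The ascending chain condition\<close>

theorem theorem6p2:
  fixes scale :: "complex \<Rightarrow> 'v::ab_group_add \<Rightarrow> 'v"
    and Y :: "'v \<Rightarrow> int \<Rightarrow> 'v \<Rightarrow> 'v"
    and vac :: 'v
    and T :: "'v \<Rightarrow> 'v"
    and gr :: "nat \<Rightarrow> 'v set"
    and I :: "nat \<Rightarrow> 'v set"
  assumes "vertex_operator_algebra scale Y vac T gr"
    and "vertex_algebra.simple scale Y T"
    and "vertex_algebra.strongly_finitely_generated scale Y vac T"
    and "\<And>n. vertex_operator_algebra.right_ideal scale Y T gr (I n)"
    and "\<And>n. I n \<subseteq> I (Suc n)"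
  shows "\<exists>N. \<forall>n\<ge>N. I n = I N"
proof -
  interpret vertex_operator_algebra scale Y vac T gr by (rule assms(1))
  show ?thesis
  proof (cases "\<forall>n. I n = {0}")
    case False
    then obtain m where m: "I m \<noteq> {0}" by blast
    have "I m \<subseteq> I (n + m)" for n by (rule lift_Suc_mono_le[of I, OF assms(5)]) simp
    then obtain N where N: "\<And>n. n \<ge> N \<Longrightarrow> I (n + m) = I (N + m)"
      using chain_above_nonzero_right_ideal[OF assms(2,3) assms(4) m, of "\<lambda>n. I (n + m)"] assms(4,5)
      by auto
    have "I n = I (N + m)" if "n \<ge> N + m" for n using N[of "n - m"] that by simp
    then show ?thesis by blast
  qed simp
qed

end
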